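(* Let $m\ge 1$ be an integer and let $S=T=\prod_{j=1}^m L\subset \mathbb{Z}_4^{2m}$. Define $$S_0=\begin{cases}\sum_{i=0}^{\frac{m-1}{2}} E_{m,2i+1} & \text{if $m$ is odd,}\\ \sum_{i=0}^{\frac{m}{2}} E_{m,2i} & \text{if $m$ is even,}\end{cases}\qquad S_1=\begin{cases}\sum_{i=0}^{\frac{m-1}{2}} E_{m,2i} & \text{if $m$ is odd,}\\ \sum_{i=0}^{\frac{m}{2}-1} E_{m,2i+1} & \text{if $m$ is even,}\end{cases}$$ which form a partition of $S$. Let $$S'=\{(0,x)\mid x\in S_0\}\cup\{(1,x)\mid x\in S_1\},\qquad T'=\{(0,x)\mid x\in T\}\cup\{(1,x)\mid x\in T^{(-1)}\}.$$ Then $S'$ and $T'$ form a primitive formally dual pair in $\mathbb{Z}_2\times\mathbb{Z}_4^{2m}$. Moreover, the following equality of multisets holds: \begin{align*} &[[T'T'^{(-1)}]_g \mid g\in \mathbb{Z}_2\times\mathbb{Z}_4^{2m}]\\ =\,&[0\langle 2^{4m+1}-10^m-13^m\rangle,\ 2^l\langle 12^{m-\frac{l-1}{2}}\tbinom{m}{\frac{l-1}{2}}+2^{2m-l+1}3^{l-1}\tbinom{m}{l-1}\rangle \mid 1\le l\le m+1,\ l\text{ odd}]\\ &\cup[2^l\langle 2^{2m-l+1}3^{l-1}\tbinom{m}{l-1}\rangle \mid 2\le l\le m+1,\ l\text{ even}]\\ &\cup[2^l\langle 12^{m-\frac{l-1}{2}}\tbinom{m}{\frac{l-1}{2}}\rangle\mid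 m+2\le l\le 2m+1,\ l\text{ odd}]. \end{align*}
   Context: Basic sets. Let $L=\{(0,0),(0,1),(1,0),(3,3)\}$, $L_1=\{(0,0),(0,1),(1,0)\}$, $L_2=\{(3,3)\}$, all subsets of $\mathbb{Z}_4^2$. Identify $\mathbb{Z}_4^{2m}$ with $(\mathbb{Z}_4^2)^m$; $\prod$ denotes Cartesian product. For $0\le i\le m$, $E_{m,i}\subset\mathbb{Z}_4^{2m}$ is $$E_{m,i}=\sum \prod_{j=1}^m N_j,$$ where the sum runs over all choices of $(N_1,\dots,N_m)\in\{L_1,L_2\}^m$ with exactly $i$ of the $N_j$ equal to $L_1$ and $m-i$ equal to $L_2$; sums of pairwise disjoint subsets (in the group ring) are identified with their unions. Group ring notation. Groups are finite abelian. A subset $A$ of $G$ is identified with $\sum_{a\in A}a\in\mathbb{Z}[G]$. For $A=\sum_g a_g g\in\mathbb{Z}[G]$, $A^{(-1)}=\sum_g a_g g^{-1}$ (so for a subset of an additively written group, $A^{(-1)}=\{-a\mid a\in A\}$), products are taken in $\mathbb{Z}[G]$, and $[A]_g$ is the coefficient of $g$ in $A$. Thus for a subset $A$, $[AA^{(-1)}]_g$ is the number of pairs $(a_1,a_2)\in A\times A$ with $a_1a_2^{-1}=g$ (i.e. $a_1-a_2=g$ in additive notation). Multiset notation. $[a_i\langle z_i\rangle\mid 1\le i\le t]$ is the multiset in which $a_i$ occurs $z_i$ times. In the first bracket of the claim, the entry $0\langle\cdots\rangle$ appears once and the range of $l$ applies to the entries $2^l\langle\cdots\rangle$. $\binom{a}{b}=0$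 if $b>a$. Formally dual pairs. Let $\Delta:G\to\widehat{G}$ be a group isomorphism onto the character group, $\Delta(y)=\chi_y$, and write $\chi(A)=\sum_{x\in A}\chi(x)$. For a subset $A\subset G$ let $\nu_A(y)=|\{(a_1,a_2)\in A\times A\mid y=a_1a_2^{-1}\}|$. Subsets $S,T\subset G$ form a formally dual pair in $G$ (under $\Delta$) if $|\chi_y(S)|^2=\frac{|S|^2}{|T|}\nu_T(y)$ for each $y\in G$. For $G=\mathbb{Z}_2\times\mathbb{Z}_4^{2m}$ the isomorphism used is $(w,z)\mapsto\phi_{w,z}$ with $\phi_{w,z}((a,b))=(-1)^{wa}(\sqrt{-1})^{z\cdot b}$, where $z\cdot b=\sum_i z_ib_i$. Primitivity. A subset $S\subset G$ is primitive if $S$ is not contained in a coset of a proper subgroup of $G$ and $S$ is not a union of cosets of a nontrivial subgroup of $G$. A formally dual pair $S,T$ is primitive if both $S$ and $T$ are primitive subsets of $G$. *)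

theory Defs
  imports
    Complex_Main
    "HOL-Algebra.Algebra"
    "HOL-Library.Multiset"
    "HOL-Library.Disjoint_Sets"
    "HOL-Library.Indicator_Function"
begin

section \<open>Characters and formally dual pairs\<close>

definition complex_mult_group :: "complex monoid" where
  "complex_mult_group = \<lparr>carrier = - {0}, monoid.mult = (*), one = 1\<rparr>"

text \<open>Characters are taken to be extensional, so that a character is determined by its
  values on the carrier.\<close>

definition character_group :: "('a, 'b) monoid_scheme \<Rightarrow> ('a \<Rightarrow> complex) monoid" where
  "character_group G =
     \<lparr>carrier = hom G complex_mult_group \<inter> extensional (carrier G),
      monoid.mult = (\<lambda>\<chi> \<psi>. \<lambda>x\<in>carrier G. \<chi> x * \<psi> x),
      one = (\<lambda>x\<in>carrier G. 1)\<rparr>"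

definition char_sum :: "('a \<Rightarrow> complex) \<Rightarrow> 'a set \<Rightarrow> complex" where
  "char_sum \<chi> A = (\<Sum>x\<in>A. \<chi> x)"

definition weight :: "('a, 'b) monoid_scheme \<Rightarrow> 'a set \<Rightarrow> 'a \<Rightarrow> nat" where
  "weight G A y = card {(a1, a2) \<in> A \<times> A. y = a1 \<otimes>\<^bsub>G\<^esub> inv\<^bsub>G\<^esub> a2}"

definition formally_dual_pair ::
  "('a, 'b) monoid_scheme \<Rightarrow> ('a \<Rightarrow> 'a \<Rightarrow> complex) \<Rightarrow> 'a set \<Rightarrow> 'a set \<Rightarrow> bool" where
  "formally_dual_pair G \<Delta> S T \<longleftrightarrow>
     comm_group G \<and> finite (carrier G) \<and> \<Delta> \<in> iso G (character_group G) \<and>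
     S \<subseteq> carrier G \<and> T \<subseteq> carrier G \<and>
     (\<forall>y\<in>carrier G. (cmod (char_sum (\<Delta> y) S))\<^sup>2 =
        (real (card S))\<^sup>2 / real (card T) * real (weight G T y))"

definition primitive_subset :: "('a, 'b) monoid_scheme \<Rightarrow> 'a set \<Rightarrow> bool" where
  "primitive_subset G S \<longleftrightarrow>
     S \<subseteq> carrier G \<and>
     \<not> (\<exists>H. subgroup H G \<and> H \<noteq> carrier G \<and> (\<exists>C \<in> rcosets\<^bsub>G\<^esub> H. S \<subseteq> C)) \<and>
     \<not> (\<exists>H. subgroup H G \<and> H \<noteq> {\<one>\<^bsub>G\<^esub>} \<and> (\<exists>\<C> \<subseteq> rcosets\<^bsub>G\<^esub> H. S = \<Union>\<C>))"

definition primitive_formally_dual_pair ::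
  "('a, 'b) monoid_scheme \<Rightarrow> ('a \<Rightarrow> 'a \<Rightarrow> complex) \<Rightarrow> 'a set \<Rightarrow> 'a set \<Rightarrow> bool" where
  "primitive_formally_dual_pair G \<Delta> S T \<longleftrightarrow>
     formally_dual_pair G \<Delta> S T \<and> primitive_subset G S \<and> primitive_subset G T"

section \<open>The integral group ring\<close>

text \<open>An element of the group ring of a finite group is its coefficient function, which
  vanishes off the carrier. A subset \<open>A\<close> is identified with \<open>indicator A\<close>.\<close>

definition gr_mult ::
  "('a, 'b) monoid_scheme \<Rightarrow> ('a \<Rightarrow> int) \<Rightarrow> ('a \<Rightarrow> int) \<Rightarrow> 'a \<Rightarrow> int" where
  "gr_mult G A B g =
     (\<Sum>(h, k) \<in> {(h, k) \<in> carrier G \<times> carrier G. h \<otimes>\<^bsub>G\<^esub> k = g}. A h * B k)"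

definition gr_inv :: "('a, 'b) monoid_scheme \<Rightarrow> ('a \<Rightarrow> int) \<Rightarrow> 'a \<Rightarrow> int" where
  "gr_inv G A g = (if g \<in> carrier G then A (inv\<^bsub>G\<^esub> g) else 0)"

section \<open>The construction\<close>

text \<open>The group \<open>\<int>\<^sub>4\<^sup>2\<^sup>m\<close> is represented as \<open>(\<int>\<^sub>4\<^sup>2)\<^sup>m\<close>, with the \<open>m\<close> factors indexed by \<open>{1..m}\<close>.\<close>

definition Z4_pow :: "nat \<Rightarrow> (nat \<Rightarrow> int \<times> int) monoid" where
  "Z4_pow m = product_group {1..m} (\<lambda>_. integer_mod_group 4 \<times>\<times> integer_mod_group 4)"

definition Z2_Z4_pow :: "nat \<Rightarrow> (int \<times> (nat \<Rightarrow> int \<times> int)) monoid" where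
  "Z2_Z4_pow m = integer_mod_group 2 \<times>\<times> Z4_pow m"

definition dot :: "nat \<Rightarrow> (nat \<Rightarrow> int \<times> int) \<Rightarrow> (nat \<Rightarrow> int \<times> int) \<Rightarrow> int" where
  "dot m z b = (\<Sum>j\<in>{1..m}. fst (z j) * fst (b j) + snd (z j) * snd (b j))"

definition phi ::
  "nat \<Rightarrow> int \<times> (nat \<Rightarrow> int \<times> int) \<Rightarrow> int \<times> (nat \<Rightarrow> int \<times> int) \<Rightarrow> complex" where
  "phi m = (\<lambda>(w, z). \<lambda>(a, b)\<in>carrier (Z2_Z4_pow m). (-1) powi (w * a) * \<i> powi (dot m z b))"

definition L_set :: "(int \<times> int) set" where
  "L_set = {(0, 0), (0, 1), (1, 0), (3, 3)}"

definition L1_set :: "(int \<times> int) set" where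
  "L1_set = {(0, 0), (0, 1), (1, 0)}"

definition L2_set :: "(int \<times> int) set" where
  "L2_set = {(3, 3)}"

text \<open>The products below are pairwise disjoint because \<open>L1_set\<close> and \<open>L2_set\<close> are, so their
  sum in the group ring is their union. The same applies to the sums of the sets \<open>E_set m i\<close>
  over distinct \<open>i\<close>.\<close>

definition E_set :: "nat \<Rightarrow> nat \<Rightarrow> (nat \<Rightarrow> int \<times> int) set" where
  "E_set m i =
     (\<Union>N \<in> {N \<in> {1..m} \<rightarrow>\<^sub>E {L1_set, L2_set}.
              card {j \<in> {1..m}. N j = L1_set} = i \<and> card {j \<in> {1..m}. N j = L2_set} = m - i}.
        \<Pi>\<^sub>E j\<in>{1..m}. N j)"

definition S_base :: "nat \<Rightarrow> (nat \<Rightarrow> int \<times> int) set" where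
  "S_base m = (\<Pi>\<^sub>E j\<in>{1..m}. L_set)"

definition T_base :: "nat \<Rightarrow> (nat \<Rightarrow> int \<times> int) set" where
  "T_base m = (\<Pi>\<^sub>E j\<in>{1..m}. L_set)"

definition S0_part :: "nat \<Rightarrow> (nat \<Rightarrow> int \<times> int) set" where
  "S0_part m =
     (if odd m then (\<Union>i\<in>{0..(m - 1) div 2}. E_set m (2 * i + 1))
      else (\<Union>i\<in>{0..m div 2}. E_set m (2 * i)))"

definition S1_part :: "nat \<Rightarrow> (nat \<Rightarrow> int \<times> int) set" where
  "S1_part m =
     (if odd m then (\<Union>i\<in>{0..(m - 1) div 2}. E_set m (2 * i))
      else (\<Union>i\<in>{0..m div 2 - 1}. E_set m (2 * i + 1)))"

definition S_lift :: "nat \<Rightarrow> (int \<times> (nat \<Rightarrow> int \<times> int)) set" where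
  "S_lift m = {(0, x) |x. x \<in> S0_part m} \<union> {(1, x) |x. x \<in> S1_part m}"

definition T_lift :: "nat \<Rightarrow> (int \<times> (nat \<Rightarrow> int \<times> int)) set" where
  "T_lift m = {(0, x) |x. x \<in> T_base m} \<union> {(1, x) |x. x \<in> set_inv\<^bsub>Z4_pow m\<^esub> (T_base m)}"

end

theory Submission
  imports Defs "HOL-Number_Theory.Cong"
begin

text \<open>
  Everything reduces to a single coordinate. Counting the coordinates with value \<open>(3, 3)\<close>, that is, the
  factors \<open>L_2\<close>, turns the definition of \<open>S_0\<close> and \<open>S_1\<close> into a parity condition that does not depend
  on the parity of \<open>m\<close> (\<open>S0_part_eq\<close>, \<open>S1_part_eq\<close>). So \<open>S'\<close> is the graph of a parity that is additive over
  the coordinates, and its character sum at \<open>(w, z)\<close> is a product over the coordinates \<open>j\<close>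
  (\<open>char_sum_S_lift\<close>): the factors are the character sums of \<open>L\<close> if \<open>w = 0\<close>, and of the difference
  of \<open>L_1\<close> and \<open>L_2\<close> if \<open>w = 1\<close>.

  On the other side, \<open>T'\<close> consists of two layers that are powers of \<open>L\<close> and \<open>-L\<close>. Its weight at
  \<open>(w, z)\<close> is twice the product over \<open>j\<close> of the numbers \<open>overlap w (z j)\<close>, where \<open>overlap 0\<close> is the
  autocorrelation of \<open>L\<close> and \<open>overlap 1\<close> counts the \<open>s\<close> in \<open>L\<close> with \<open>t + s\<close> in \<open>-L\<close>
  (\<open>weight_T_lift\<close>). The duality then follows from the identity in \<open>\<int>\<^sub>4\<^sup>2\<close> that the squared modulus of the
  local character sum at \<open>t\<close> is \<open>4 * overlap w t\<close> (\<open>cmod_local_char_sum\<close>), which is a check of 32 cases.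

  Primitivity uses that both sets contain 0 and generate the group, and that they have no period: a
  period and its double would both lie in the set, while 0 is the only element of \<open>L\<close> with even entries
  (\<open>sheet_double_eq_zero\<close>). This leaves the exchange of the two layers, which is not a period of \<open>S'\<close> because
  no point of \<open>S\<close> occurs over both 0 and 1, and not one of \<open>T'\<close> because \<open>L\<close> differs from \<open>-L\<close>.

  Finally, \<open>overlap 0\<close> takes the values 4, 1, 0 on 1, 12, 3 elements of \<open>\<int>\<^sub>4\<^sup>2\<close>, and \<open>overlap 1\<close> takes the values
  2, 1, 0 on 6, 4, 6 elements. The multiset of weights is the multiset of doubled products of such
  values, so its multiplicities are the terms of the binomial expansions of \<open>(1 + 12) ^ m\<close> and
  \<open>(6 + 4) ^ m\<close>, and 0 takes what remains of the \<open>16 ^ m\<close> elements of each layer (\<open>image_mset_prod_PiE\<close>).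
\<close>

section \<open>Primitivity and autocorrelation in groups\<close>

text \<open>For a set containing the identity, the two conditions of primitivity become handier: a coset
  containing the set is a subgroup, and a set is a union of cosets of \<open>H\<close> only if all elements of \<open>H\<close>
  are periods of it.\<close>

lemma (in group) primitive_subsetI:
  assumes sub: "A \<subseteq> carrier G" and one: "\<one> \<in> A"
    and gen: "\<And>H. subgroup H G \<Longrightarrow> A \<subseteq> H \<Longrightarrow> carrier G \<subseteq> H"
    and period: "\<And>h. h \<in> carrier G \<Longrightarrow> (\<And>a. a \<in> A \<Longrightarrow> h \<otimes> a \<in> A) \<Longrightarrow> h = \<one>"
  shows "primitive_subset G A"
  unfolding primitive_subset_def
proof (intro conjI notI sub)
  assume "\<exists>H. subgroup H G \<and> H \<noteq> carrier G \<and> (\<exists>C\<in>rcosets H. A \<subseteq> C)"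
  then obtain H c where H: "subgroup H G" "H \<noteq> carrier G" and c: "c \<in> carrier G" "A \<subseteq> H #> c"
    by (auto simp: RCOSETS_def)
  have "H #> c = H #> \<one>"
    by (rule repr_independence) (use c one H in auto)
  also have "\<dots> = H" using H subgroup.subset by (intro coset_mult_one) auto
  finally have "carrier G \<subseteq> H" using c gen[OF H(1)] by simp
  with H show False using subgroup.subset by blast
next
  assume "\<exists>H. subgroup H G \<and> H \<noteq> {\<one>} \<and> (\<exists>\<C>\<subseteq>rcosets H. A = \<Union>\<C>)"
  then obtain H \<C> where H: "subgroup H G" "H \<noteq> {\<one>}" and C: "\<C> \<subseteq> rcosets H" "A = \<Union>\<C>"
    by blast
  have "h \<otimes> a \<in> A" if h: "h \<in> H" and a: "a \<in> A" for h a
  proof -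
    obtain C where "C \<in> \<C>" "a \<in> C" using C a by blast
    moreover obtain c where "c \<in> carrier G" "C = H #> c"
      using C \<open>C \<in> \<C>\<close> by (auto simp: RCOSETS_def)
    ultimately have C_eq: "C = H #> a" using repr_independence H(1) by blast
    have "h \<otimes> a \<in> C" unfolding C_eq r_coset_def using h by blast
    then show ?thesis using C \<open>C \<in> \<C>\<close> by blast
  qed
  then have "h = \<one>" if "h \<in> H" for h
    using that period subgroup.mem_carrier[OF H(1)] by blast
  then show False using H subgroup.one_closed by blast
qed

text \<open>The second member of a pair with quotient \<open>y\<close> determines the first. In this form the weight of a
  product set is a product of weights.\<close>

lemma (in group) weight_eq_card_translates:
  assumes "A \<subseteq> carrier G" "y \<in> carrier G"
  shows "weight G A y = card {a \<in> A. y \<otimes> a \<in> A}"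
proof -
  have "bij_betw (\<lambda>a. (y \<otimes> a, a)) {a \<in> A. y \<otimes> a \<in> A} {(a1, a2) \<in> A \<times> A. y = a1 \<otimes> inv a2}"
    using assms by (intro bij_betw_byWitness[where f' = snd]) (auto simp: subset_iff inv_solve_right m_assoc)
  then show ?thesis unfolding weight_def by (simp add: bij_betw_same_card)
qed

lemma (in group) gr_mult_indicator_inv:
  assumes fin: "finite (carrier G)" and A: "A \<subseteq> carrier G"
  shows "gr_mult G (indicator A) (gr_inv G (indicator A)) g = int (weight G A g)"
proof -
  let ?P = "{(h, k) \<in> carrier G \<times> carrier G. h \<otimes> k = g}"
  have finP: "finite ?P"
    by (rule finite_subset[of _ "carrier G \<times> carrier G"]) (use fin in auto)
  have "gr_mult G (indicator A) (gr_inv G (indicator A)) g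
      = (\<Sum>p\<in>?P. if fst p \<in> A \<and> inv (snd p) \<in> A then 1 else 0)"
    unfolding gr_mult_def by (rule sum.cong) (auto simp: gr_inv_def indicator_def)
  also have "\<dots> = int (card {p \<in> ?P. fst p \<in> A \<and> inv (snd p) \<in> A})"
    using sum.inter_filter[OF finP, of "\<lambda>_. 1 :: int" "\<lambda>p. fst p \<in> A \<and> inv (snd p) \<in> A"] by simp
  also have "card {p \<in> ?P. fst p \<in> A \<and> inv (snd p) \<in> A} = card {(a1, a2) \<in> A \<times> A. g = a1 \<otimes> inv a2}"
    by (rule bij_betw_same_card[where f = "\<lambda>(h, k). (h, inv k)"],
        rule bij_betw_byWitness[where f' = "\<lambda>(h, k). (h, inv k)"]) (use A in auto)
  finally show ?thesis by (simp add: weight_def)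
qed

section \<open>The group and its generators\<close>

abbreviation Z44 :: "(int \<times> int) monoid" where
  "Z44 \<equiv> integer_mod_group 4 \<times>\<times> integer_mod_group 4"

definition C4 :: "(int \<times> int) set" where
  "C4 = {0, 1, 2, 3} \<times> {0, 1, 2, 3}"

abbreviation add4 :: "int \<times> int \<Rightarrow> int \<times> int \<Rightarrow> int \<times> int" where
  "add4 s t \<equiv> ((fst s + fst t) mod 4, (snd s + snd t) mod 4)"

definition coord :: "nat \<Rightarrow> nat \<Rightarrow> int \<times> int \<Rightarrow> nat \<Rightarrow> int \<times> int" where
  "coord m j s = (\<lambda>i\<in>{1..m}. if i = j then s else (0, 0))"

lemma carrier_Z44: "carrier Z44 = C4"
proof -
  have "{0..<4 :: int} = {0, 1, 2, 3}" by (simp add: set_eq_iff) presburger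
  then show ?thesis by (simp add: carrier_integer_mod_group C4_def)
qed

lemma mod_4_C4:
  assumes "s \<in> C4"
  shows "fst s mod 4 = fst s" "snd s mod 4 = snd s"
  using assms by (auto simp: C4_def)

lemma finite_C4: "finite C4" by (simp add: C4_def)

lemma card_C4: "card C4 = 16" by (simp add: C4_def)

lemma carrier_Z4_pow: "carrier (Z4_pow m) = (\<Pi>\<^sub>E j\<in>{1..m}. C4)"
  by (simp add: Z4_pow_def carrier_Z44 del: carrier_DirProd)

lemma carrier_Z2_Z4_pow: "carrier (Z2_Z4_pow m) = {0, 1} \<times> (\<Pi>\<^sub>E j\<in>{1..m}. C4)"
  by (auto simp: Z2_Z4_pow_def carrier_Z4_pow carrier_integer_mod_group)

lemma one_Z2_Z4_pow: "\<one>\<^bsub>Z2_Z4_pow m\<^esub> = (0, \<lambda>j\<in>{1..m}. (0, 0))"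
  by (simp add: Z2_Z4_pow_def Z4_pow_def)

lemma mult_Z2_Z4_pow:
  "(w, z) \<otimes>\<^bsub>Z2_Z4_pow m\<^esub> (w', z') = ((w + w') mod 2, \<lambda>j\<in>{1..m}. add4 (z j) (z' j))"
  by (simp add: Z2_Z4_pow_def Z4_pow_def mult_DirProd')

lemma comm_group_Z2_Z4_pow: "comm_group (Z2_Z4_pow m)"
proof (rule group.group_comm_groupI)
  show "Group.group (Z2_Z4_pow m)"
    by (simp add: Z2_Z4_pow_def Z4_pow_def DirProd_group)
qed (auto simp: mult_Z2_Z4_pow add.commute)

lemma finite_Z2_Z4_pow: "finite (carrier (Z2_Z4_pow m))"
  by (auto simp: carrier_Z2_Z4_pow C4_def intro!: finite_PiE)

lemma coord_zero: "coord m j (0, 0) = (\<lambda>j\<in>{1..m}. (0, 0))"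
  by (auto simp: coord_def)

lemma coord_in_PiE: "(0, 0) \<in> B \<Longrightarrow> s \<in> B \<Longrightarrow> coord m j s \<in> (\<Pi>\<^sub>E j\<in>{1..m}. B)"
  by (simp add: coord_def restrict_PiE_iff)

lemma coord_in_carrier:
  assumes "s \<in> C4" "w \<in> {0, 1}"
  shows "(w, coord m j s) \<in> carrier (Z2_Z4_pow m)"
  using assms by (auto simp: carrier_Z2_Z4_pow coord_def C4_def)

lemma mult_coord:
  "(w, coord m j s) \<otimes>\<^bsub>Z2_Z4_pow m\<^esub> (w', coord m j t) = ((w + w') mod 2, coord m j (add4 s t))"
  unfolding mult_Z2_Z4_pow coord_def
  by (simp only: prod.inject, intro conjI restrict_ext) auto

text \<open>Stated for multiplicatively closed sets, so that it applies both to subgroups, in the proofs of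
  primitivity, and to the set on which two characters agree.\<close>

lemma Z2_Z4_pow_generated:
  assumes one: "\<one>\<^bsub>Z2_Z4_pow m\<^esub> \<in> H"
    and mult: "\<And>x y. x \<in> H \<Longrightarrow> y \<in> H \<Longrightarrow> x \<otimes>\<^bsub>Z2_Z4_pow m\<^esub> y \<in> H"
    and gen0: "(1, \<lambda>j\<in>{1..m}. (0, 0)) \<in> H"
    and gen: "\<And>j s. j \<in> {1..m} \<Longrightarrow> s \<in> {(1, 0), (0, 1)} \<Longrightarrow> (0, coord m j s) \<in> H"
  shows "carrier (Z2_Z4_pow m) \<subseteq> H"
proof -
  have coord: "(0, coord m j s) \<in> H" if j: "j \<in> {1..m}" and s: "s \<in> C4" for j s
  proof -
    let ?D = "{s. (0, coord m j s) \<in> H}"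
    have add: "((a + c) mod 4, (b + d) mod 4) \<in> ?D" if "(a, b) \<in> ?D" "(c, d) \<in> ?D" for a b c d
    proof -
      have "(0, coord m j (a, b)) \<otimes>\<^bsub>Z2_Z4_pow m\<^esub> (0, coord m j (c, d))
            = (0, coord m j ((a + c) mod 4, (b + d) mod 4))"
        by (simp add: mult_coord)
      then show ?thesis using mult that by (metis mem_Collect_eq)
    qed
    have 10: "(1, 0) \<in> ?D" and 01: "(0, 1) \<in> ?D" using gen[OF j] by auto
    have 00: "(0, 0) \<in> ?D" using one by (simp add: one_Z2_Z4_pow coord_zero)
    have 20: "(2, 0) \<in> ?D" using add[OF 10 10] by simp
    have 30: "(3, 0) \<in> ?D" using add[OF 20 10] by simp
    have a0: "(a, 0) \<in> ?D" if "a \<in> {0, 1, 2, 3}" for a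
      using that 00 10 20 30 by blast
    have a1: "(a, 1) \<in> ?D" if "a \<in> {0, 1, 2, 3}" for a
      using add[OF a0[OF that] 01] that by auto
    have a2: "(a, 2) \<in> ?D" if "a \<in> {0, 1, 2, 3}" for a
      using add[OF a1[OF that] 01] that by auto
    have a3: "(a, 3) \<in> ?D" if "a \<in> {0, 1, 2, 3}" for a
      using add[OF a2[OF that] 01] that by auto
    show ?thesis using s a0 a1 a2 a3 unfolding C4_def by blast
  qed
  \<comment> \<open>Induction over the support builds every vector from vectors supported on one coordinate.\<close>
  have z: "(0, \<lambda>j\<in>{1..m}. if j \<in> J then z j else (0, 0)) \<in> H"
    if "finite J" "J \<subseteq> {1..m}" and z: "z \<in> (\<Pi>\<^sub>E j\<in>{1..m}. C4)" for J z
    using that(1,2)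
  proof (induction J)
    case empty
    then show ?case using one unfolding one_Z2_Z4_pow by (simp only: empty_iff if_False)
  next
    case (insert k J)
    have zk: "fst (z i) mod 4 = fst (z i)" "snd (z i) mod 4 = snd (z i)" if "i \<in> {1..m}" for i
      using mod_4_C4[OF PiE_mem[OF z that]] by simp_all
    have sum: "(0, \<lambda>j\<in>{1..m}. if j \<in> J then z j else (0, 0)) \<otimes>\<^bsub>Z2_Z4_pow m\<^esub> (0, coord m k (z k))
        = (0, \<lambda>j\<in>{1..m}. if j \<in> insert k J then z j else (0, 0))"
      unfolding mult_Z2_Z4_pow using insert.hyps(2)
      by (simp only: prod.inject, intro conjI restrict_ext)
        (auto simp: coord_def zk simp del: atLeastAtMost_iff)
    have k_in: "(0, coord m k (z k)) \<in> H"
    proof -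
      have k: "k \<in> {1..m}" using insert.prems by simp
      show ?thesis by (rule coord[OF k PiE_mem[OF z k]])
    qed
    have J_in: "(0, \<lambda>j\<in>{1..m}. if j \<in> J then z j else (0, 0)) \<in> H"
      by (rule insert.IH) (use insert.prems in simp)
    show ?case using mult[OF J_in k_in] unfolding sum .
  qed
  have z: "(0, z) \<in> H" if "z \<in> (\<Pi>\<^sub>E j\<in>{1..m}. C4)" for z
  proof -
    have "(\<lambda>j\<in>{1..m}. if j \<in> {1..m} then z j else (0, 0)) = z"
      using that by (auto simp: PiE_def extensional_def)
    then show ?thesis using z[of "{1..m}" z] that by simp
  qed
  have "(1, z) \<in> H" if "z \<in> (\<Pi>\<^sub>E j\<in>{1..m}. C4)" for z
  proof -
    have "(\<lambda>j\<in>{1..m}. ((0 + fst (z j)) mod 4, (0 + snd (z j)) mod 4)) = z"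
    proof
      fix j show "(\<lambda>j\<in>{1..m}. ((0 + fst (z j)) mod 4, (0 + snd (z j)) mod 4)) j = z j"
        using mod_4_C4[OF PiE_mem[OF that, of j]] PiE_arb[OF that, of j] by auto
    qed
    then have "(1, \<lambda>j\<in>{1..m}. (0, 0)) \<otimes>\<^bsub>Z2_Z4_pow m\<^esub> (0, z) = (1, z)"
      by (simp add: mult_Z2_Z4_pow cong: restrict_cong)
    then show ?thesis using mult[OF gen0 z[OF that]] by simp
  qed
  with z show ?thesis by (auto simp: carrier_Z2_Z4_pow)
qed

section \<open>The isomorphism onto the character group\<close>

lemma i_powi_mod_4: "\<i> powi (n mod 4) = \<i> powi n"
proof -
  have "\<i> powi n = \<i> powi (4 * (n div 4) + n mod 4)" by simp
  also have "\<dots> = (\<i> powi 4) powi (n div 4) * \<i> powi (n mod 4)"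
    by (simp only: power_int_add power_int_mult complex_i_not_zero simp_thms)
  finally show ?thesis by simp
qed

lemma i_powi_values:
  "\<i> powi 0 = 1" "\<i> powi 1 = \<i>" "\<i> powi 2 = -1" "\<i> powi 3 = -\<i>"
  by (simp_all add: power3_eq_cube)

lemma i_powi_cases:
  "\<i> powi n = (if n mod 4 = 0 then 1 else if n mod 4 = 1 then \<i> else if n mod 4 = 2 then -1 else -\<i>)"
proof -
  have "n mod 4 = 0 \<or> n mod 4 = 1 \<or> n mod 4 = 2 \<or> n mod 4 = 3" by presburger
  then show ?thesis using i_powi_values i_powi_mod_4[of n] by (elim disjE) simp_all
qed

lemma i_powi_eq_iff: "\<i> powi a = \<i> powi b \<longleftrightarrow> [a = b] (mod 4)"
proof -
  have mod4: "x mod 4 = 0 \<or> x mod 4 = 1 \<or> x mod 4 = 2 \<or> x mod 4 = 3" for x :: int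
    by presburger
  have "1 \<noteq> \<i>" "1 \<noteq> -\<i>" "\<i> \<noteq> -\<i>" "-1 \<noteq> -\<i>" "-1 \<noteq> \<i>" "(-1 :: complex) \<noteq> 1"
    by (simp_all add: complex_eq_iff)
  then have "\<i> powi (a mod 4) = \<i> powi (b mod 4) \<longleftrightarrow> a mod 4 = b mod 4"
    using mod4[of a] mod4[of b] by (elim disjE) (metis i_powi_values)+
  then show ?thesis by (simp add: i_powi_mod_4 cong_def)
qed

lemma i_powi_sum: "\<i> powi (\<Sum>x\<in>A. f x) = (\<Prod>x\<in>A. \<i> powi f x)"
  by (induction A rule: infinite_finite_induct) (simp_all add: power_int_add)

lemma fourth_root_of_unity:
  assumes "(c :: complex) ^ 4 = 1"
  obtains t where "t \<in> {0, 1, 2, 3}" "c = \<i> powi t"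
proof -
  have "(c - 1) * (c + 1) * (c - \<i>) * (c + \<i>) = c ^ 4 - 1"
    by (simp add: algebra_simps eval_nat_numeral)
  with assms consider "c = 1" | "c = -1" | "c = \<i>" | "c = -\<i>"
    by (auto simp: eq_neg_iff_add_eq_0)
  then show ?thesis
  proof cases
    case 1 then show ?thesis using that[of 0] by simp
  next
    case 2 then show ?thesis using that[of 2] by simp
  next
    case 3 then show ?thesis using that[of 1] by simp
  next
    case 4 then show ?thesis using that[of 3] by (simp add: eval_nat_numeral)
  qed
qed

text \<open>Since \<open>-1 = \<i>\<^sup>2\<close>, both factors of \<open>phi\<close> combine into one
  power of \<open>\<i>\<close>. The pairing is symmetric and, modulo 4, bilinear, so bilinearity in one argument yields
  both that each \<open>phi m g\<close> is a character and that \<open>phi m\<close> is a homomorphism.\<close>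

definition pairing :: "nat \<Rightarrow> int \<times> (nat \<Rightarrow> int \<times> int) \<Rightarrow> int \<times> (nat \<Rightarrow> int \<times> int) \<Rightarrow> int" where
  "pairing m g h = 2 * fst g * fst h + dot m (snd g) (snd h)"

lemma phi_eq_pairing:
  assumes "h \<in> carrier (Z2_Z4_pow m)"
  shows "phi m g h = \<i> powi pairing m g h"
proof -
  have "(-1 :: complex) powi n = \<i> powi (2 * n)" for n
    by (simp add: power_int_mult)
  with assms show ?thesis
    by (simp add: phi_def pairing_def power_int_add mult.assoc split: prod.splits)
qed

lemma pairing_commute: "pairing m g h = pairing m h g"
  by (simp add: pairing_def dot_def mult.commute)

text \<open>The binary coordinate is only defined modulo 2, but it enters with the factor 2.\<close>

lemma pairing_mult:
  "[pairing m (g \<otimes>\<^bsub>Z2_Z4_pow m\<^esub> g') h = pairing m g h + pairing m g' h] (mod 4)"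
proof -
  obtain w z w' z' a b where eq: "g = (w, z)" "g' = (w', z')" "h = (a, b)"
    by (metis surj_pair)
  have "[2 * ((w + w') mod 2) * a = 2 * (w + w') * a] (mod 4)"
  proof -
    have "2 * ((w + w') mod 2) mod 4 = 2 * (w + w') mod 4"
      using mult_mod_right[of 2 "w + w'" 2] by simp
    then have "[2 * ((w + w') mod 2) = 2 * (w + w')] (mod 4)" by (simp add: cong_def)
    then show ?thesis by (rule cong_mult) (rule cong_refl)
  qed
  moreover have "[dot m (\<lambda>j\<in>{1..m}. ((fst (z j) + fst (z' j)) mod 4, (snd (z j) + snd (z' j)) mod 4)) b
      = (\<Sum>j\<in>{1..m}. (fst (z j) + fst (z' j)) * fst (b j) + (snd (z j) + snd (z' j)) * snd (b j))] (mod 4)"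
    unfolding dot_def
  proof (rule cong_sum)
    fix j assume "j \<in> {1..m}"
    then show "[fst ((\<lambda>j\<in>{1..m}. ((fst (z j) + fst (z' j)) mod 4, (snd (z j) + snd (z' j)) mod 4)) j) * fst (b j)
      + snd ((\<lambda>j\<in>{1..m}. ((fst (z j) + fst (z' j)) mod 4, (snd (z j) + snd (z' j)) mod 4)) j) * snd (b j)
      = (fst (z j) + fst (z' j)) * fst (b j) + (snd (z j) + snd (z' j)) * snd (b j)] (mod 4)"
      by (auto intro!: cong_add cong_mult)
  qed
  moreover have "(\<Sum>j\<in>{1..m}. (fst (z j) + fst (z' j)) * fst (b j) + (snd (z j) + snd (z' j)) * snd (b j))
     = dot m z b + dot m z' b"
    unfolding dot_def sum.distrib[symmetric] by (rule sum.cong) (simp_all add: algebra_simps)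
  ultimately have "[2 * ((w + w') mod 2) * a + dot m (snd (g \<otimes>\<^bsub>Z2_Z4_pow m\<^esub> g')) b
     = 2 * (w + w') * a + (dot m z b + dot m z' b)] (mod 4)"
    by (intro cong_add) (simp_all add: eq mult_Z2_Z4_pow)
  then show ?thesis
    by (simp add: pairing_def eq mult_Z2_Z4_pow algebra_simps)
qed

lemma dot_coord:
  assumes "j \<in> {1..m}"
  shows "dot m z (coord m j s) = fst (z j) * fst s + snd (z j) * snd s"
proof -
  have "dot m z (coord m j s) = (\<Sum>i\<in>{1..m}. if i = j then fst (z j) * fst s + snd (z j) * snd s else 0)"
    unfolding dot_def by (rule sum.cong) (auto simp: coord_def)
  then show ?thesis using assms by simp
qed

lemma phi_mult_left:
  assumes "h \<in> carrier (Z2_Z4_pow m)"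
  shows "phi m (g \<otimes>\<^bsub>Z2_Z4_pow m\<^esub> g') h = phi m g h * phi m g' h"
proof -
  have "\<i> powi pairing m (g \<otimes>\<^bsub>Z2_Z4_pow m\<^esub> g') h = \<i> powi (pairing m g h + pairing m g' h)"
    using pairing_mult i_powi_eq_iff by blast
  then show ?thesis using assms by (simp add: phi_eq_pairing power_int_add)
qed

lemma phi_mult_right:
  assumes "h \<in> carrier (Z2_Z4_pow m)" "h' \<in> carrier (Z2_Z4_pow m)"
  shows "phi m g (h \<otimes>\<^bsub>Z2_Z4_pow m\<^esub> h') = phi m g h * phi m g h'"
proof -
  interpret comm_group "Z2_Z4_pow m" by (rule comm_group_Z2_Z4_pow)
  have "\<i> powi pairing m g (h \<otimes>\<^bsub>Z2_Z4_pow m\<^esub> h') = \<i> powi (pairing m g h + pairing m g h')"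
    using pairing_mult[of m h h' g] i_powi_eq_iff by (simp add: pairing_commute)
  then show ?thesis using assms by (simp add: phi_eq_pairing power_int_add)
qed

lemma phi_in_character_group:
  assumes "g \<in> carrier (Z2_Z4_pow m)"
  shows "phi m g \<in> carrier (character_group (Z2_Z4_pow m))"
proof -
  have "phi m g \<in> extensional (carrier (Z2_Z4_pow m))"
    by (cases g) (simp add: phi_def)
  moreover have "phi m g \<in> hom (Z2_Z4_pow m) complex_mult_group"
    by (rule homI) (simp_all add: complex_mult_group_def phi_mult_right, simp add: phi_eq_pairing)
  ultimately show ?thesis by (simp add: character_group_def)
qed

text \<open>Injectivity holds because the values on the generators determine \<open>g\<close>. Surjectivity holds because a
  character is determined by its values on the generators, and these are roots of unity of the right order.\<close>

lemma phi_iso: "phi m \<in> iso (Z2_Z4_pow m) (character_group (Z2_Z4_pow m))"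
proof -
  let ?G = "Z2_Z4_pow m" and ?o = "\<lambda>j\<in>{1..m}. (0, 0) :: int \<times> int"
  interpret comm_group ?G by (rule comm_group_Z2_Z4_pow)
  have o: "(1, ?o) \<in> carrier ?G" by (auto simp: carrier_Z2_Z4_pow C4_def)
  have phi_o: "phi m (w, z) (1, ?o) = \<i> powi (2 * w)" for w z
    using o by (simp add: phi_eq_pairing pairing_def dot_def)
  have phi_coord: "phi m (w, z) (0, coord m j s) = \<i> powi (fst (z j) * fst s + snd (z j) * snd s)"
    if "j \<in> {1..m}" "s \<in> C4" for w z j s
    using that by (simp add: phi_eq_pairing coord_in_carrier pairing_def dot_coord)
  have "phi m \<in> hom ?G (character_group ?G)"
  proof (rule homI)
    fix g g' assume gg': "g \<in> carrier ?G" "g' \<in> carrier ?G"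
    show "phi m (g \<otimes>\<^bsub>?G\<^esub> g') = phi m g \<otimes>\<^bsub>character_group ?G\<^esub> phi m g'"
    proof
      fix h
      have "phi m (g \<otimes>\<^bsub>?G\<^esub> g') h = undefined" if "h \<notin> carrier ?G"
        using that by (simp add: phi_def split: prod.splits)
      then show "phi m (g \<otimes>\<^bsub>?G\<^esub> g') h = (phi m g \<otimes>\<^bsub>character_group ?G\<^esub> phi m g') h"
        by (cases "h \<in> carrier ?G") (simp_all add: character_group_def phi_mult_left)
    qed
  qed (rule phi_in_character_group)
  moreover have "inj_on (phi m) (carrier ?G)"
  proof (rule inj_onI)
    fix g g' assume g: "g \<in> carrier ?G" "g' \<in> carrier ?G" and eq: "phi m g = phi m g'"
    obtain w z w' z' where gz: "g = (w, z)" "g' = (w', z')" by (metis surj_pair)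
    have "[2 * w = 2 * w'] (mod 4)"
      using phi_o[of w z] phi_o[of w' z'] eq gz unfolding i_powi_eq_iff[symmetric] by simp
    moreover have "w \<in> {0, 1}" "w' \<in> {0, 1}" using g gz by (auto simp: carrier_Z2_Z4_pow)
    ultimately have w: "w = w'" by (auto simp: cong_def)
    have z: "z \<in> (\<Pi>\<^sub>E j\<in>{1..m}. C4)" "z' \<in> (\<Pi>\<^sub>E j\<in>{1..m}. C4)"
      using g gz by (auto simp: carrier_Z2_Z4_pow)
    have "z = z'"
    proof (rule PiE_ext[OF z])
      fix j assume j: "j \<in> {1..m}"
      have "[fst (z j) = fst (z' j)] (mod 4)" "[snd (z j) = snd (z' j)] (mod 4)"
        using phi_coord[OF j, of "(1, 0)" w z] phi_coord[OF j, of "(1, 0)" w' z']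
          phi_coord[OF j, of "(0, 1)" w z] phi_coord[OF j, of "(0, 1)" w' z'] eq gz
        unfolding i_powi_eq_iff[symmetric] by (simp_all add: C4_def)
      then show "z j = z' j"
        using PiE_mem[OF z(1) j] PiE_mem[OF z(2) j] by (auto simp: C4_def cong_def)
    qed
    with w gz show "g = g'" by simp
  qed
  moreover have "\<exists>g\<in>carrier ?G. \<chi> = phi m g" if "\<chi> \<in> carrier (character_group ?G)" for \<chi>
  proof -
    have hom: "\<chi> (x \<otimes>\<^bsub>?G\<^esub> y) = \<chi> x * \<chi> y" if "x \<in> carrier ?G" "y \<in> carrier ?G" for x y
      using \<open>\<chi> \<in> _\<close> that by (simp add: character_group_def complex_mult_group_def hom_def)
    have nz: "\<chi> x \<noteq> 0" if "x \<in> carrier ?G" for x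
      using \<open>\<chi> \<in> _\<close> that by (auto simp: character_group_def complex_mult_group_def hom_def Pi_iff)
    have chi_one: "\<chi> \<one>\<^bsub>?G\<^esub> = 1"
      using hom[of "\<one>\<^bsub>?G\<^esub>" "\<one>\<^bsub>?G\<^esub>"] nz[of "\<one>\<^bsub>?G\<^esub>"] by simp
    \<comment> \<open>The generators have orders 2 and 4, so the values of \<open>\<chi>\<close> on them are second and fourth roots
      of unity; their exponents are the only candidate for the preimage of \<open>\<chi>\<close>.\<close>
    have "(1, ?o) \<otimes>\<^bsub>?G\<^esub> (1, ?o) = \<one>\<^bsub>?G\<^esub>"
      by (simp add: mult_Z2_Z4_pow one_Z2_Z4_pow cong: restrict_cong)
    with hom[OF o o] chi_one have "\<chi> (1, ?o) * \<chi> (1, ?o) = 1" by simp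
    then have "\<chi> (1, ?o) = 1 \<or> \<chi> (1, ?o) = -1" by (simp add: square_eq_1_iff)
    then have "\<exists>w::int. w \<in> {0, 1} \<and> \<chi> (1, ?o) = \<i> powi (2 * w)"
    proof
      assume "\<chi> (1, ?o) = 1"
      then show ?thesis by (intro exI[of _ 0]) simp
    next
      assume "\<chi> (1, ?o) = -1"
      then show ?thesis by (intro exI[of _ 1]) simp
    qed
    then obtain w :: int where w: "w \<in> {0, 1}" "\<chi> (1, ?o) = \<i> powi (2 * w)" by blast
    have twice_twice: "2 * (2 * a mod 4) mod 4 = 0" for a :: int by presburger
    have root: "\<exists>t. t \<in> {0, 1, 2, 3} \<and> \<chi> (0, coord m j s) = \<i> powi t"
      if s: "s \<in> C4" for j s
    proof -
      have c: "(0, coord m j s) \<in> carrier ?G" using s by (simp add: coord_in_carrier)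
      let ?c = "(0, coord m j s)"
      have "(?c \<otimes>\<^bsub>?G\<^esub> ?c) \<otimes>\<^bsub>?G\<^esub> (?c \<otimes>\<^bsub>?G\<^esub> ?c) = \<one>\<^bsub>?G\<^esub>"
        unfolding mult_Z2_Z4_pow one_Z2_Z4_pow
        by (simp only: prod.inject, intro conjI restrict_ext) (simp_all add: twice_twice)
      then have "(\<chi> ?c * \<chi> ?c) * (\<chi> ?c * \<chi> ?c) = 1"
        using hom[OF c c] hom[of "?c \<otimes>\<^bsub>?G\<^esub> ?c" "?c \<otimes>\<^bsub>?G\<^esub> ?c"] c chi_one by simp
      then have "\<chi> ?c ^ 4 = 1" by (simp add: eval_nat_numeral mult.assoc)
      then show ?thesis by (metis fourth_root_of_unity)
    qed
    define t where "t j s = (SOME t. t \<in> {0, 1, 2, 3} \<and> \<chi> (0, coord m j s) = \<i> powi t)" for j s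
    have t: "t j s \<in> {0, 1, 2, 3}" "\<chi> (0, coord m j s) = \<i> powi t j s" if "s \<in> C4" for j s
      using someI_ex[OF root[OF that, of j]] unfolding t_def by blast+
    define z where "z = (\<lambda>j\<in>{1..m}. (t j (1, 0), t j (0, 1)))"
    have gens: "(1, 0) \<in> C4" "(0, 1) \<in> C4" by (simp_all add: C4_def)
    have "(t j (1, 0), t j (0, 1)) \<in> C4" for j
      using t(1)[OF gens(1)] t(1)[OF gens(2)] unfolding C4_def by (rule SigmaI)
    then have g: "(w, z) \<in> carrier ?G"
      using w(1) unfolding carrier_Z2_Z4_pow z_def by auto
    \<comment> \<open>Two characters agree on a multiplicatively closed set, and here that set contains the generators.\<close>
    have "carrier ?G \<subseteq> {h \<in> carrier ?G. \<chi> h = phi m (w, z) h}"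
    proof (rule Z2_Z4_pow_generated)
      show "\<one>\<^bsub>?G\<^esub> \<in> {h \<in> carrier ?G. \<chi> h = phi m (w, z) h}"
        using chi_one by (simp add: phi_eq_pairing) (simp add: one_Z2_Z4_pow pairing_def dot_def)
      show "(1, ?o) \<in> {h \<in> carrier ?G. \<chi> h = phi m (w, z) h}"
        using w o phi_o by simp
      fix j and s :: "int \<times> int" assume "j \<in> {1..m}" "s \<in> {(1, 0), (0, 1)}"
      moreover from this have "s \<in> C4" by (auto simp: C4_def)
      ultimately show "(0, coord m j s) \<in> {h \<in> carrier ?G. \<chi> h = phi m (w, z) h}"
        using t(2)[of s j] by (auto simp: coord_in_carrier phi_coord z_def)
    qed (auto simp: hom phi_mult_right)
    moreover have "\<chi> \<in> extensional (carrier ?G)" "phi m (w, z) \<in> extensional (carrier ?G)"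
      using \<open>\<chi> \<in> _\<close> phi_in_character_group[OF g] by (auto simp: character_group_def)
    ultimately have "\<chi> = phi m (w, z)" by (intro extensionalityI) auto
    with g show ?thesis by blast
  qed
  ultimately show ?thesis
    using phi_in_character_group by (fastforce simp: iso_def bij_betw_def)
qed

section \<open>The partition as a parity condition\<close>

text \<open>The number of factors \<open>L_2\<close> of the product of sets \<open>L_1\<close>, \<open>L_2\<close> that contains \<open>x\<close>; its parity
  decides into which half of the partition \<open>x\<close> falls.\<close>

definition twists :: "nat \<Rightarrow> (nat \<Rightarrow> int \<times> int) \<Rightarrow> nat" where
  "twists m x = card {j \<in> {1..m}. x j = (3, 3)}"

text \<open>A point of the product of copies of \<open>L\<close> lies in exactly one product of sets \<open>L_1\<close>, \<open>L_2\<close>, and the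
  factors \<open>L_2\<close> of that product are at the positions where the point takes the value \<open>(3, 3)\<close>.\<close>

lemma E_set_eq: "E_set m i = {x \<in> S_base m. i + twists m x = m}"
proof (intro Set.set_eqI iffI)
  fix x assume "x \<in> E_set m i"
  then obtain N where N: "N \<in> {1..m} \<rightarrow>\<^sub>E {L1_set, L2_set}" "x \<in> (\<Pi>\<^sub>E j\<in>{1..m}. N j)"
    and card1: "card {j \<in> {1..m}. N j = L1_set} = i"
    and card2: "card {j \<in> {1..m}. N j = L2_set} = m - i"
    unfolding E_set_def by blast
  have ne: "L1_set \<noteq> L2_set" by (auto simp: L1_set_def L2_set_def)
  have "x j \<in> L_set \<and> (x j = (3, 3) \<longleftrightarrow> N j = L2_set)" if j: "j \<in> {1..m}" for j
  proof -
    have "N j = L1_set \<or> N j = L2_set" using PiE_mem[OF N(1) j] by simp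
    then show ?thesis
      using PiE_mem[OF N(2) j] ne by (elim disjE) (auto simp: L_set_def L1_set_def L2_set_def)
  qed
  then have "x \<in> S_base m" "{j \<in> {1..m}. x j = (3, 3)} = {j \<in> {1..m}. N j = L2_set}"
    using N(2) by (auto simp: S_base_def PiE_iff)
  moreover have "i \<le> m"
    using card_mono[of "{1..m}" "{j \<in> {1..m}. N j = L1_set}"] unfolding card1 by fastforce
  ultimately show "x \<in> {x \<in> S_base m. i + twists m x = m}"
    using card2 by (simp add: twists_def)
next
  fix x assume "x \<in> {x \<in> S_base m. i + twists m x = m}"
  then have x: "x \<in> (\<Pi>\<^sub>E j\<in>{1..m}. L_set)" and i: "i + twists m x = m"
    by (auto simp: S_base_def)
  define N where "N = (\<lambda>j\<in>{1..m}. if x j = (3, 3) then L2_set else L1_set)"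
  have ne: "L1_set \<noteq> L2_set" by (auto simp: L1_set_def L2_set_def)
  have "{j \<in> {1..m}. N j = L2_set} = {j \<in> {1..m}. x j = (3, 3)}"
    using ne by (auto simp: N_def)
  then have 2: "card {j \<in> {1..m}. N j = L2_set} = m - i" using i by (simp add: twists_def)
  have "{j \<in> {1..m}. N j = L1_set} = {1..m} - {j \<in> {1..m}. x j = (3, 3)}"
    using ne by (auto simp: N_def)
  then have "card {j \<in> {1..m}. N j = L1_set} = card {1..m} - twists m x"
    unfolding twists_def by (simp only:) (rule card_Diff_subset, auto)
  then have 1: "card {j \<in> {1..m}. N j = L1_set} = i" using i by simp
  have "N \<in> {1..m} \<rightarrow>\<^sub>E {L1_set, L2_set}" by (simp add: N_def PiE_iff)
  moreover have "x \<in> (\<Pi>\<^sub>E j\<in>{1..m}. N j)"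
    using x by (auto simp: N_def PiE_iff L_set_def L1_set_def L2_set_def)
  ultimately show "x \<in> E_set m i" using 1 2 unfolding E_set_def by blast
qed

lemma twists_le: "twists m x \<le> m"
proof -
  have "twists m x \<le> card {1..m}"
    unfolding twists_def by (rule card_mono) auto
  then show ?thesis by simp
qed

lemma parity_diff:
  fixes n k i :: nat
  shows "2 * i + k = n \<Longrightarrow> even k \<longleftrightarrow> even n" "Suc (2 * i + k) = n \<Longrightarrow> even k \<longleftrightarrow> odd n"
  by presburger+

lemma even_complement_index:
  fixes k n :: nat
  assumes "k \<le> n" "even k \<longleftrightarrow> even n"
  shows "\<exists>i\<in>{0..n div 2}. 2 * i + k = n"
proof -
  have "even (n - k)" using assms by simp
  then obtain i where "n - k = 2 * i" by (rule evenE)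
  with assms(1) show ?thesis by (intro bexI[of _ i]) auto
qed

lemma odd_complement_index:
  fixes k n :: nat
  assumes "k \<le> n" "even k \<longleftrightarrow> odd n"
  shows "\<exists>i\<in>{0..(n - 1) div 2}. 2 * i + 1 + k = n"
proof -
  have "odd (n - k)" using assms by simp
  then obtain i where "n - k = 2 * i + 1" by (rule oddE)
  with assms(1) show ?thesis by (intro bexI[of _ i]) auto
qed

text \<open>The case distinction on the parity of \<open>m\<close> in the construction disappears when the factors \<open>L_2\<close>
  are counted instead of the factors \<open>L_1\<close>.\<close>

lemma S0_part_eq: "S0_part m = {x \<in> S_base m. even (twists m x)}"
proof (intro Set.set_eqI iffI)
  fix x assume "x \<in> S0_part m"
  then show "x \<in> {x \<in> S_base m. even (twists m x)}"
    by (auto simp: S0_part_def E_set_eq split: if_splits dest: parity_diff)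
next
  fix x assume x: "x \<in> {x \<in> S_base m. even (twists m x)}"
  have "\<exists>i\<in>{0..(m - 1) div 2}. 2 * i + 1 + twists m x = m" if "odd m"
    using that x twists_le[of m x] by (intro odd_complement_index) auto
  moreover have "\<exists>i\<in>{0..m div 2}. 2 * i + twists m x = m" if "even m"
    using that x twists_le[of m x] by (intro even_complement_index) auto
  ultimately show "x \<in> S0_part m"
    using x by (auto simp: S0_part_def E_set_eq)
qed

lemma S1_part_eq: "S1_part m = {x \<in> S_base m. odd (twists m x)}"
proof (intro Set.set_eqI iffI)
  fix x assume "x \<in> S1_part m"
  then show "x \<in> {x \<in> S_base m. odd (twists m x)}"
    by (auto simp: S1_part_def E_set_eq split: if_splits dest: parity_diff)
next
  fix x assume x: "x \<in> {x \<in> S_base m. odd (twists m x)}"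
  have "\<exists>i\<in>{0..(m - 1) div 2}. 2 * i + twists m x = m" if "odd m"
  proof -
    have "(m - 1) div 2 = m div 2" using that by presburger
    then show ?thesis using that x twists_le[of m x] even_complement_index[of "twists m x" m] by auto
  qed
  moreover have "\<exists>i\<in>{0..m div 2 - 1}. 2 * i + 1 + twists m x = m" if "even m"
  proof -
    have "(m - 1) div 2 = m div 2 - 1" using that by presburger
    then show ?thesis using that x twists_le[of m x] odd_complement_index[of "twists m x" m] by auto
  qed
  ultimately show "x \<in> S1_part m"
    using x by (auto simp: S1_part_def E_set_eq)
qed

text \<open>The lift is the graph of the twist parity, which is additive over the coordinates. Hence its character
  sums factor.\<close>

lemma S_lift_eq: "S_lift m = (\<lambda>x. (int (twists m x mod 2), x)) ` S_base m"
  by (auto simp: S_lift_def S0_part_eq S1_part_eq image_iff even_iff_mod_2_eq_zero odd_iff_mod_2_eq_one)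

lemma S_lift_iff: "(w, x) \<in> S_lift m \<longleftrightarrow> x \<in> (\<Pi>\<^sub>E j\<in>{1..m}. L_set) \<and> w = int (twists m x mod 2)"
  by (auto simp: S_lift_eq S_base_def)

lemma twists_coord: "twists m (coord m j s) = of_bool (j \<in> {1..m} \<and> s = (3, 3))"
proof -
  have "{i \<in> {1..m}. coord m j s i = (3, 3)} = (if j \<in> {1..m} \<and> s = (3, 3) then {j} else {})"
    by (auto simp: coord_def split: if_splits)
  then show ?thesis by (simp add: twists_def)
qed

section \<open>The two layers of the second set\<close>

text \<open>The coordinate set of each layer of the lifted \<open>T\<close>: \<open>L\<close> over 0 and \<open>-L\<close> over 1.\<close>

definition sheet :: "int \<Rightarrow> (int \<times> int) set" where
  "sheet u = (if u = 0 then L_set else {(0, 0), (0, 3), (3, 0), (1, 1)})"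

lemma sheet_0: "sheet 0 = {(0, 0), (0, 1), (1, 0), (3, 3)}"
  by (simp add: sheet_def L_set_def)

lemma sheet_1: "sheet 1 = {(0, 0), (0, 3), (3, 0), (1, 1)}"
  by (simp add: sheet_def)

lemma L_set_eq_sheet: "L_set = sheet 0"
  by (simp add: sheet_def)

lemma finite_sheet: "finite (sheet u)"
  by (simp add: sheet_def L_set_def)

lemma card_L_set: "card L_set = 4" and card_sheet: "card (sheet u) = 4"
  by (auto simp: L_set_def sheet_def)

lemma sheet_subset: "sheet u \<subseteq> C4"
  by (auto simp: sheet_def L_set_def C4_def)

lemma PiE_sheet_subset: "(\<Pi>\<^sub>E j\<in>{1..m}. sheet u) \<subseteq> (\<Pi>\<^sub>E j\<in>{1..m}. C4)"
  by (rule PiE_mono) (rule sheet_subset)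

lemma T_lift_eq: "T_lift m = (SIGMA u:{0, 1}. \<Pi>\<^sub>E j\<in>{1..m}. sheet u)"
proof -
  define neg :: "int \<times> int \<Rightarrow> int \<times> int" where "neg s = (- fst s mod 4, - snd s mod 4)" for s
  have inv_Z44: "inv\<^bsub>Z44\<^esub> s = neg s" if "s \<in> C4" for s
    using that by (cases s) (simp add: carrier_Z44[symmetric] neg_def)
  have inv: "inv\<^bsub>Z4_pow m\<^esub> x = (\<lambda>j\<in>{1..m}. neg (x j))" if "x \<in> (\<Pi>\<^sub>E j\<in>{1..m}. sheet u)" for x u
  proof -
    have "x \<in> (\<Pi>\<^sub>E j\<in>{1..m}. carrier Z44)"
      using that sheet_subset unfolding carrier_Z44 by (auto simp: PiE_iff)
    moreover have "neg (x j) = inv\<^bsub>Z44\<^esub> (x j)" if "j \<in> {1..m}" for j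
      using inv_Z44 PiE_mem[OF \<open>x \<in> (\<Pi>\<^sub>E j\<in>{1..m}. carrier Z44)\<close> that]
      unfolding carrier_Z44 by simp
    ultimately show ?thesis
      unfolding Z4_pow_def by (subst inv_product_group) (auto simp: DirProd_group)
  qed
  have neg: "neg ` sheet 0 = sheet 1" "neg ` sheet 1 = sheet 0"
    by (auto simp: neg_def sheet_def L_set_def)
  have neg_neg: "neg (neg s) = s" if "s \<in> sheet 1" for s
    using that by (auto simp: neg_def sheet_def)
  have "set_inv\<^bsub>Z4_pow m\<^esub> (T_base m) = (\<lambda>x. \<lambda>j\<in>{1..m}. neg (x j)) ` (\<Pi>\<^sub>E j\<in>{1..m}. sheet 0)"
    using inv[of _ 0] by (auto simp: SET_INV_def T_base_def sheet_def)
  also have "\<dots> = (\<Pi>\<^sub>E j\<in>{1..m}. sheet 1)"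
  proof (intro subset_antisym subsetI)
    fix y assume y: "y \<in> (\<Pi>\<^sub>E j\<in>{1..m}. sheet 1)"
    have "y = (\<lambda>j\<in>{1..m}. neg ((\<lambda>j\<in>{1..m}. neg (y j)) j))"
      using PiE_mem[OF y] PiE_arb[OF y] neg_neg by (auto simp: fun_eq_iff simp del: atLeastAtMost_iff)
    moreover have "(\<lambda>j\<in>{1..m}. neg (y j)) \<in> (\<Pi>\<^sub>E j\<in>{1..m}. sheet 0)"
      using PiE_mem[OF y] neg(2) by auto
    ultimately show "y \<in> (\<lambda>x. \<lambda>j\<in>{1..m}. neg (x j)) ` (\<Pi>\<^sub>E j\<in>{1..m}. sheet 0)" by blast
  next
    fix y assume "y \<in> (\<lambda>x. \<lambda>j\<in>{1..m}. neg (x j)) ` (\<Pi>\<^sub>E j\<in>{1..m}. sheet 0)"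
    then obtain x where x: "x \<in> (\<Pi>\<^sub>E j\<in>{1..m}. sheet 0)" and y: "y = (\<lambda>j\<in>{1..m}. neg (x j))"
      by blast
    have "neg (x j) \<in> sheet 1" if "j \<in> {1..m}" for j
      using imageI[OF PiE_mem[OF x that], of neg] unfolding neg(1) .
    then show "y \<in> (\<Pi>\<^sub>E j\<in>{1..m}. sheet 1)" unfolding y by (simp add: restrict_PiE_iff)
  qed
  finally show ?thesis
    by (auto simp: T_lift_def T_base_def sheet_def)
qed

lemma T_lift_iff: "(u, x) \<in> T_lift m \<longleftrightarrow> u \<in> {0, 1} \<and> x \<in> (\<Pi>\<^sub>E j\<in>{1..m}. sheet u)"
  by (simp add: T_lift_eq)

lemma S_lift_subset: "S_lift m \<subseteq> carrier (Z2_Z4_pow m)"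
proof
  fix h assume "h \<in> S_lift m"
  then obtain x where "h = (int (twists m x mod 2), x)" "x \<in> (\<Pi>\<^sub>E j\<in>{1..m}. sheet 0)"
    by (auto simp: S_lift_eq S_base_def L_set_eq_sheet)
  moreover have "int (k mod 2) \<in> {0, 1}" for k :: nat by (cases "even k") (auto simp: odd_iff_mod_2_eq_one)
  ultimately show "h \<in> carrier (Z2_Z4_pow m)"
    using PiE_sheet_subset[of m 0] unfolding carrier_Z2_Z4_pow by blast
qed

lemma T_lift_subset: "T_lift m \<subseteq> carrier (Z2_Z4_pow m)"
  using PiE_sheet_subset[of m] unfolding carrier_Z2_Z4_pow T_lift_eq by blast

section \<open>Computations in one coordinate\<close>

text \<open>For \<open>w = 0\<close> this is the autocorrelation of \<open>L\<close> at \<open>t\<close>; for \<open>w = 1\<close> it is the number of ways of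
  writing \<open>-t\<close> as a sum of two elements of \<open>L\<close>.\<close>

definition overlap :: "int \<Rightarrow> int \<times> int \<Rightarrow> nat" where
  "overlap w t = card {s \<in> sheet 0. add4 t s \<in> sheet w}"

text \<open>The facts about a single coordinate below are verified on all 16 elements.\<close>

lemma ball_C4:
  "(\<forall>t\<in>C4. P t) \<longleftrightarrow>
    P (0, 0) \<and> P (0, 1) \<and> P (0, 2) \<and> P (0, 3) \<and> P (1, 0) \<and> P (1, 1) \<and> P (1, 2) \<and> P (1, 3) \<and>
    P (2, 0) \<and> P (2, 1) \<and> P (2, 2) \<and> P (2, 3) \<and> P (3, 0) \<and> P (3, 1) \<and> P (3, 2) \<and> P (3, 3)"
  unfolding C4_def by blast

lemma card_filter_4:
  assumes "distinct [a, b, c, d]"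
  shows "card {x \<in> {a, b, c, d}. P x} = of_bool (P a) + of_bool (P b) + of_bool (P c) + of_bool (P d)"
proof -
  have "{x \<in> {a, b, c, d}. P x} = (if P a then {a} else {}) \<union> (if P b then {b} else {})
      \<union> (if P c then {c} else {}) \<union> (if P d then {d} else {})"
    by auto
  then show ?thesis using assms by (auto simp: card_insert_if)
qed

lemma card_filter_sheet:
  "card {s \<in> sheet 0. P s} = of_bool (P (0, 0)) + of_bool (P (0, 1)) + of_bool (P (1, 0)) + of_bool (P (3, 3))"
  "card {s \<in> sheet 1. P s} = of_bool (P (0, 0)) + of_bool (P (0, 3)) + of_bool (P (3, 0)) + of_bool (P (1, 1))"
  unfolding sheet_0 sheet_1 by (rule card_filter_4, simp)+

text \<open>The count does not depend on the layer from which one starts. For \<open>w = 0\<close> this is the symmetry of an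
  autocorrelation; for \<open>w = 1\<close> it says that \<open>t\<close> and \<open>-t\<close> have equally many representations as
  sums of two elements of \<open>L\<close>, a special property of this set.\<close>

lemma overlap_sheet:
  assumes "t \<in> C4" "u \<in> {0, 1}" "w \<in> {0, 1}"
  shows "card {s \<in> sheet u. add4 t s \<in> sheet ((w + u) mod 2)} = overlap w t"
proof -
  have 0: "\<forall>t\<in>C4. card {s \<in> sheet 1. add4 t s \<in> sheet 1} = overlap 0 t"
    unfolding overlap_def ball_C4 card_filter_sheet by (simp add: sheet_0 sheet_1)
  have 1: "\<forall>t\<in>C4. card {s \<in> sheet 1. add4 t s \<in> sheet 0} = overlap 1 t"
    unfolding overlap_def ball_C4 card_filter_sheet by (simp add: sheet_0 sheet_1)
  have "w = 0 \<or> w = 1" "u = 0 \<or> u = 1" using assms by simp_all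
  then show ?thesis
    using assms(1) 0 1 by (elim disjE) (simp_all add: overlap_def)
qed

lemma overlap_0:
  assumes "t \<in> C4"
  shows "overlap 0 t = (if t = (0, 0) then 4 else if t \<in> {(0, 2), (2, 0), (2, 2)} then 0 else 1)"
proof -
  have "\<forall>t\<in>C4. overlap 0 t = (if t = (0, 0) then 4 else if t \<in> {(0, 2), (2, 0), (2, 2)} then 0 else 1)"
    unfolding overlap_def ball_C4 card_filter_sheet by (simp add: sheet_0)
  with assms show ?thesis by blast
qed

lemma overlap_1:
  assumes "t \<in> C4"
  shows "overlap 1 t = (if t \<in> {(0, 1), (1, 0), (3, 3), (0, 3), (3, 0), (1, 1)} then 2
    else if t \<in> {(0, 0), (0, 2), (2, 0), (2, 2)} then 1 else 0)"
proof -
  have "\<forall>t\<in>C4. overlap 1 t = (if t \<in> {(0, 1), (1, 0), (3, 3), (0, 3), (3, 0), (1, 1)} then 2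
    else if t \<in> {(0, 0), (0, 2), (2, 0), (2, 2)} then 1 else 0)"
    unfolding overlap_def ball_C4 card_filter_sheet by (simp add: sheet_0 sheet_1)
  with assms show ?thesis by blast
qed

text \<open>The 13 nonzero values over \<open>w = 0\<close> and the 10 nonzero values over \<open>w = 1\<close> are the bases in the
  multiplicity of 0.\<close>

lemma card_overlap:
  "card {t \<in> C4. overlap 0 t = 4} = 1" "card {t \<in> C4. overlap 0 t = 1} = 12"
  "card {t \<in> C4. overlap 1 t = 2} = 6" "card {t \<in> C4. overlap 1 t = 1} = 4"
proof -
  have "{t \<in> C4. overlap 0 t = 4} = {(0, 0)}"
    by (auto simp: overlap_0 C4_def)
  then show "card {t \<in> C4. overlap 0 t = 4} = 1" by simp
  have "{t \<in> C4. overlap 0 t = 1} = C4 - {(0, 0), (0, 2), (2, 0), (2, 2)}"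
    by (auto simp: overlap_0 split: if_splits)
  then show "card {t \<in> C4. overlap 0 t = 1} = 12"
    by (simp add: card_Diff_subset C4_def)
  have "{t \<in> C4. overlap 1 t = 2} = {(0, 1), (1, 0), (3, 3), (0, 3), (3, 0), (1, 1)}"
    by (auto simp: overlap_1 C4_def split: if_splits)
  then show "card {t \<in> C4. overlap 1 t = 2} = 6" by simp
  have "{t \<in> C4. overlap 1 t = 1} = {(0, 0), (0, 2), (2, 0), (2, 2)}"
    by (auto simp: overlap_1 C4_def split: if_splits)
  then show "card {t \<in> C4. overlap 1 t = 1} = 4" by simp
qed

text \<open>The duality in one coordinate. For \<open>w = 0\<close> it is the formal self-duality of \<open>L\<close>. For \<open>w = 1\<close> the sign
  at \<open>(3, 3)\<close> turns \<open>L\<close> into the difference of \<open>L_1\<close> and \<open>L_2\<close>, and the autocorrelation of \<open>L\<close> into its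
  correlation with \<open>-L\<close>.\<close>

lemma cmod_local_char_sum:
  assumes "t \<in> C4" "w \<in> {0, 1}"
  shows "(cmod (\<Sum>s\<in>L_set. \<i> powi (2 * w * of_bool (s = (3, 3)) + (fst t * fst s + snd t * snd s))))\<^sup>2
    = 4 * real (overlap w t)"
proof -
  have C4: "\<forall>t\<in>C4. t \<in> C4" by blast
  have "\<forall>t\<in>C4. (cmod (\<Sum>s\<in>L_set. \<i> powi (fst t * fst s + snd t * snd s)))\<^sup>2 = 4 * real (overlap 0 t)"
    using C4 unfolding ball_C4 by (simp add: overlap_0 L_set_def i_powi_cases cmod_power2)
  moreover have "\<forall>t\<in>C4. (cmod (\<Sum>s\<in>L_set. \<i> powi (2 * of_bool (s = (3, 3)) + (fst t * fst s + snd t * snd s))))\<^sup>2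
      = 4 * real (overlap 1 t)"
    using C4 unfolding ball_C4 by (simp add: overlap_1 L_set_def i_powi_cases cmod_power2)
  ultimately show ?thesis using assms by auto
qed

text \<open>Doubles have even entries, and \<open>(0, 0)\<close> is the only element with even entries in \<open>L\<close>, and likewise in \<open>-L\<close>. Hence the
  first component is all that can be nonzero in a period of a lifted set.\<close>

lemma sheet_double_eq_zero:
  assumes "s \<in> sheet u" "add4 s s \<in> sheet 0"
  shows "s = (0, 0)"
  using assms by (auto simp: sheet_def L_set_def split: if_splits)

section \<open>Formal duality\<close>

text \<open>The two starting layers contribute the same product, whence the factor 2.\<close>

lemma weight_T_lift:
  assumes "w \<in> {0, 1}" and z: "z \<in> (\<Pi>\<^sub>E j\<in>{1..m}. C4)"
  shows "weight (Z2_Z4_pow m) (T_lift m) (w, z) = 2 * (\<Prod>j\<in>{1..m}. overlap w (z j))"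
proof -
  let ?G = "Z2_Z4_pow m"
  interpret comm_group ?G by (rule comm_group_Z2_Z4_pow)
  let ?F = "\<lambda>u j. {s \<in> sheet u. add4 (z j) s \<in> sheet ((w + u) mod 2)}"
  have "weight ?G (T_lift m) (w, z) = card {a \<in> T_lift m. (w, z) \<otimes>\<^bsub>?G\<^esub> a \<in> T_lift m}"
    using assms T_lift_subset by (intro weight_eq_card_translates) (auto simp: carrier_Z2_Z4_pow)
  also have "{a \<in> T_lift m. (w, z) \<otimes>\<^bsub>?G\<^esub> a \<in> T_lift m} = (SIGMA u:{0, 1}. \<Pi>\<^sub>E j\<in>{1..m}. ?F u j)"
  proof -
    have "(u, x) \<in> T_lift m \<and> (w, z) \<otimes>\<^bsub>?G\<^esub> (u, x) \<in> T_lift m \<longleftrightarrow>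
        u \<in> {0, 1} \<and> x \<in> (\<Pi>\<^sub>E j\<in>{1..m}. ?F u j)" for u x
    proof -
      have "(w + u) mod 2 \<in> {0, 1}" by auto
      then show ?thesis
        unfolding T_lift_iff mult_Z2_Z4_pow restrict_PiE_iff by (auto simp: PiE_iff)
    qed
    then show ?thesis by auto
  qed
  also have "card \<dots> = (\<Sum>u\<in>{0, 1}. \<Prod>j\<in>{1..m}. card (?F u j))"
    by (subst card_SigmaI) (auto simp: card_PiE finite_sheet intro!: finite_PiE)
  also have "\<dots> = (\<Sum>u\<in>{0, 1 :: int}. \<Prod>j\<in>{1..m}. overlap w (z j))"
    using assms(1) PiE_mem[OF z] by (intro sum.cong prod.cong refl overlap_sheet) auto
  finally show ?thesis by simp
qed

lemma char_sum_S_lift: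
  assumes "w \<in> {0, 1}" and z: "z \<in> (\<Pi>\<^sub>E j\<in>{1..m}. C4)"
  shows "char_sum (phi m (w, z)) (S_lift m) =
    (\<Prod>j\<in>{1..m}. \<Sum>s\<in>L_set. \<i> powi (2 * w * of_bool (s = (3, 3)) + (fst (z j) * fst s + snd (z j) * snd s)))"
proof -
  let ?f = "\<lambda>j s. 2 * w * of_bool (s = (3, 3)) + (fst (z j) * fst s + snd (z j) * snd s)"
  have "char_sum (phi m (w, z)) (S_lift m) =
      (\<Sum>x\<in>S_base m. phi m (w, z) (int (twists m x mod 2), x))"
    unfolding char_sum_def S_lift_eq by (subst sum.reindex) (auto intro: inj_onI)
  also have "\<dots> = (\<Sum>x\<in>S_base m. \<Prod>j\<in>{1..m}. \<i> powi ?f j (x j))"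
  proof (rule sum.cong)
    fix x assume x: "x \<in> S_base m"
    then have "(int (twists m x mod 2), x) \<in> carrier (Z2_Z4_pow m)"
      using S_lift_subset by (auto simp: S_lift_eq)
    then have "phi m (w, z) (int (twists m x mod 2), x) = \<i> powi (2 * w * int (twists m x mod 2) + dot m z x)"
      by (simp add: phi_eq_pairing pairing_def)
    \<comment> \<open>The factor 2 makes the reduction of the twist count modulo 2 invisible modulo 4, so the
      exponent becomes a sum over the coordinates.\<close>
    also have "\<dots> = \<i> powi (2 * w * int (twists m x) + dot m z x)"
    proof -
      have "2 * w * int (twists m x mod 2) mod 4 = 2 * w * int (twists m x) mod 4"
        using assms(1) mult_mod_right[of 2 "int (twists m x)" 2] by (auto simp: zmod_int)
      then show ?thesis unfolding i_powi_eq_iff by (intro cong_add cong_refl) (simp add: cong_def)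
    qed
    also have "2 * w * int (twists m x) + dot m z x = (\<Sum>j\<in>{1..m}. ?f j (x j))"
    proof -
      have "int (twists m x) = (\<Sum>j\<in>{1..m}. of_bool (x j = (3, 3)))"
        by (simp add: twists_def Int_def)
      then show ?thesis unfolding dot_def sum.distrib by (simp add: sum_distrib_left)
    qed
    finally show "phi m (w, z) (int (twists m x mod 2), x) = (\<Prod>j\<in>{1..m}. \<i> powi ?f j (x j))"
      unfolding i_powi_sum .
  qed simp
  also have "\<dots> = (\<Prod>j\<in>{1..m}. \<Sum>s\<in>L_set. \<i> powi ?f j s)"
    unfolding S_base_def by (rule prod_sum_PiE[symmetric]) (simp_all add: L_set_def)
  finally show ?thesis .
qed

text \<open>Both sides of the duality equation are products over the coordinates, so the equation follows from
  the one for a single coordinate.\<close>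

lemma formally_dual_pair_lift: "formally_dual_pair (Z2_Z4_pow m) (phi m) (S_lift m) (T_lift m)"
proof -
  let ?G = "Z2_Z4_pow m"
  have card_S: "card (S_lift m) = 4 ^ m"
    unfolding S_lift_eq by (subst card_image) (auto intro: inj_onI simp: S_base_def card_PiE card_L_set)
  have card_T: "card (T_lift m) = 2 * 4 ^ m"
    unfolding T_lift_eq
    by (subst card_SigmaI) (auto simp: card_PiE card_sheet finite_sheet intro!: finite_PiE)
  have "(cmod (char_sum (phi m y) (S_lift m)))\<^sup>2 =
      (real (card (S_lift m)))\<^sup>2 / real (card (T_lift m)) * real (weight ?G (T_lift m) y)"
    if y: "y \<in> carrier ?G" for y
  proof -
    obtain w z where wz: "y = (w, z)" "w \<in> {0, 1}" "z \<in> (\<Pi>\<^sub>E j\<in>{1..m}. C4)"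
      using y unfolding carrier_Z2_Z4_pow by blast
    have "(cmod (char_sum (phi m y) (S_lift m)))\<^sup>2 = (\<Prod>j\<in>{1..m}. 4 * real (overlap w (z j)))"
      unfolding wz(1) char_sum_S_lift[OF wz(2,3)] prod_norm[symmetric] prod_power_distrib
      using wz(2) PiE_mem[OF wz(3)] by (intro prod.cong refl cmod_local_char_sum) auto
    also have "\<dots> = 4 ^ m * (\<Prod>j\<in>{1..m}. real (overlap w (z j)))"
      by (simp add: prod.distrib)
    also have "\<dots> = (real (card (S_lift m)))\<^sup>2 / real (card (T_lift m)) * real (weight ?G (T_lift m) y)"
      unfolding wz(1) weight_T_lift[OF wz(2,3)] card_S card_T
      by (simp add: power2_eq_square)
    finally show ?thesis .
  qed
  then show ?thesis
    unfolding formally_dual_pair_def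
    using comm_group_Z2_Z4_pow finite_Z2_Z4_pow phi_iso S_lift_subset T_lift_subset by blast
qed

section \<open>Primitivity of the lifted sets\<close>

lemma double_coordinates_zero:
  assumes x: "x \<in> (\<Pi>\<^sub>E j\<in>{1..m}. sheet u)"
    and xx: "(\<lambda>j\<in>{1..m}. add4 (x j) (x j)) \<in> (\<Pi>\<^sub>E j\<in>{1..m}. sheet 0)"
  shows "x = (\<lambda>j\<in>{1..m}. (0, 0))"
proof
  fix j
  show "x j = (\<lambda>j\<in>{1..m}. (0, 0)) j"
  proof (cases "j \<in> {1..m}")
    case True
    then show ?thesis
      using sheet_double_eq_zero[OF PiE_mem[OF x True]] PiE_mem[OF xx True] by simp
  next
    case False
    then show ?thesis using PiE_arb[OF x False] by (simp only: restrict_apply False if_False)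
  qed
qed

lemma primitive_S_lift:
  assumes "m \<ge> 1"
  shows "primitive_subset (Z2_Z4_pow m) (S_lift m)"
proof -
  let ?G = "Z2_Z4_pow m" and ?o = "\<lambda>j\<in>{1..m}. (0, 0) :: int \<times> int"
  interpret comm_group ?G by (rule comm_group_Z2_Z4_pow)
  have coord: "(of_bool (j \<in> {1..m} \<and> s = (3, 3)), coord m j s) \<in> S_lift m" if "s \<in> L_set" for j s
    using that unfolding S_lift_iff
    by (intro conjI coord_in_PiE) (auto simp: L_set_def twists_coord)
  show ?thesis
  proof (rule primitive_subsetI)
    show "\<one>\<^bsub>?G\<^esub> \<in> S_lift m"
      using coord[of "(0, 0)"] by (simp add: one_Z2_Z4_pow coord_zero L_set_def)
  next
    fix H assume H: "subgroup H ?G" "S_lift m \<subseteq> H"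
    have gen: "(0, coord m j s) \<in> H" if "s \<in> {(1, 0), (0, 1)}" for j s
      using coord[of s j] that H(2) by (auto simp: L_set_def)
    have twist: "(1, coord m 1 (3, 3)) \<in> H"
      using coord[of "(3, 3)" 1] assms H(2) by (auto simp: L_set_def)
    \<comment> \<open>Modulo 4, \<open>(3, 3) + (1, 0) + (0, 1) = (0, 0)\<close>, which isolates the binary coordinate.\<close>
    have "(1, coord m 1 (3, 3)) \<otimes>\<^bsub>?G\<^esub> (0, coord m 1 (1, 0)) \<otimes>\<^bsub>?G\<^esub> (0, coord m 1 (0, 1)) = (1, ?o)"
      unfolding mult_coord coord_zero[of m 1, symmetric] by simp
    then have "(1, ?o) \<in> H"
      using subgroup.m_closed[OF H(1) subgroup.m_closed[OF H(1) twist gen[of "(1, 0)" 1]] gen[of "(0, 1)" 1]]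
      by simp
    then show "carrier ?G \<subseteq> H"
    proof (rule Z2_Z4_pow_generated[rotated 2])
      show "\<one>\<^bsub>?G\<^esub> \<in> H" by (rule subgroup.one_closed[OF H(1)])
      show "x \<otimes>\<^bsub>?G\<^esub> y \<in> H" if "x \<in> H" "y \<in> H" for x y
        by (rule subgroup.m_closed[OF H(1) that])
      show "(0, coord m j s) \<in> H" if "s \<in> {(1, 0), (0, 1)}" for j s by (rule gen[OF that])
    qed
  next
    fix h assume "h \<in> carrier ?G" and period: "\<And>a. a \<in> S_lift m \<Longrightarrow> h \<otimes>\<^bsub>?G\<^esub> a \<in> S_lift m"
    \<comment> \<open>The identity is in the set, so a period lies in the set, and so does its double.\<close>
    then have h: "h \<in> S_lift m"
      using coord[of "(0, 0)"] by (force simp: one_Z2_Z4_pow coord_zero L_set_def dest: r_one)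
    obtain w x where wx: "h = (w, x)" by (cases h)
    have "x = ?o"
      using h period[OF h] unfolding wx mult_Z2_Z4_pow S_lift_iff L_set_eq_sheet
      by (intro double_coordinates_zero[of _ _ 0]) blast+
    moreover have "twists m ?o = 0" using twists_coord[of m 0 "(0, 0)"] by (simp add: coord_zero)
    ultimately show "h = \<one>\<^bsub>?G\<^esub>"
      using h by (simp add: wx S_lift_iff one_Z2_Z4_pow)
  qed (rule S_lift_subset)
qed

lemma primitive_T_lift:
  assumes "m \<ge> 1"
  shows "primitive_subset (Z2_Z4_pow m) (T_lift m)"
proof -
  let ?G = "Z2_Z4_pow m" and ?o = "\<lambda>j\<in>{1..m}. (0, 0) :: int \<times> int"
  interpret comm_group ?G by (rule comm_group_Z2_Z4_pow)
  have coord: "(u, coord m j s) \<in> T_lift m" if "u \<in> {0, 1}" "s \<in> sheet u" for u j s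
    using that unfolding T_lift_iff
    by (intro conjI coord_in_PiE) (auto simp: sheet_0 sheet_1)
  show ?thesis
  proof (rule primitive_subsetI)
    show "\<one>\<^bsub>?G\<^esub> \<in> T_lift m"
      using coord[of 0 "(0, 0)"] by (simp add: one_Z2_Z4_pow coord_zero sheet_0)
  next
    fix H assume H: "subgroup H ?G" "T_lift m \<subseteq> H"
    have gen: "(0, coord m j s) \<in> H" if "s \<in> {(1, 0), (0, 1)}" for j s
      using coord[of 0 s j] that H(2) by (auto simp: sheet_0)
    have "(1, ?o) \<in> H"
      using coord[of 1 "(0, 0)"] H(2) by (auto simp: sheet_1 coord_zero)
    then show "carrier ?G \<subseteq> H"
    proof (rule Z2_Z4_pow_generated[rotated 2])
      show "\<one>\<^bsub>?G\<^esub> \<in> H" by (rule subgroup.one_closed[OF H(1)])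
      show "x \<otimes>\<^bsub>?G\<^esub> y \<in> H" if "x \<in> H" "y \<in> H" for x y
        by (rule subgroup.m_closed[OF H(1) that])
      show "(0, coord m j s) \<in> H" if "s \<in> {(1, 0), (0, 1)}" for j s by (rule gen[OF that])
    qed
  next
    fix h assume "h \<in> carrier ?G" and period: "\<And>a. a \<in> T_lift m \<Longrightarrow> h \<otimes>\<^bsub>?G\<^esub> a \<in> T_lift m"
    then have h: "h \<in> T_lift m"
      using coord[of 0 "(0, 0)"] by (force simp: one_Z2_Z4_pow coord_zero sheet_0 dest: r_one)
    obtain w x where wx: "h = (w, x)" by (cases h)
    have w: "w \<in> {0, 1}" using h by (simp add: wx T_lift_iff)
    then have ww: "(w + w) mod 2 = 0" by auto
    have x: "x = ?o"
      using h period[OF h] unfolding wx mult_Z2_Z4_pow T_lift_iff ww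
      by (intro double_coordinates_zero[of _ _ w]) blast+
    \<comment> \<open>Translation by \<open>(1, 0)\<close> exchanges the two layers, but \<open>(0, 1)\<close> is in \<open>L\<close> and not in \<open>-L\<close>.\<close>
    have "w \<noteq> 1"
    proof
      assume "w = 1"
      then have "h = (1, coord m 1 (0, 0))" by (simp add: wx x coord_zero)
      then have "(1, coord m 1 (0, 1)) \<in> T_lift m"
        using period[OF coord[of 0 "(0, 1)" 1]] by (simp add: mult_coord sheet_0)
      then have in_sheet: "coord m 1 (0, 1) \<in> (\<Pi>\<^sub>E j\<in>{1..m}. sheet 1)" by (simp add: T_lift_iff)
      have "coord m 1 (0, 1) 1 \<in> sheet 1" by (rule PiE_mem[OF in_sheet]) (use assms in simp)
      then show False using assms by (simp add: coord_def sheet_1)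
    qed
    with w show "h = \<one>\<^bsub>?G\<^esub>" by (simp add: wx x one_Z2_Z4_pow)
  qed (rule T_lift_subset)
qed

section \<open>Multisets of products\<close>

lemma image_mset_sum: "image_mset f (\<Sum>x\<in>A. M x) = (\<Sum>x\<in>A. image_mset f (M x))"
  by (induction A rule: infinite_finite_induct) auto

lemma image_mset_const_on:
  assumes "finite A" "\<And>x. x \<in> A \<Longrightarrow> f x = c"
  shows "image_mset f (mset_set A) = replicate_mset (card A) c"
proof -
  have "image_mset f (mset_set A) = image_mset (\<lambda>_. c) (mset_set A)"
    using assms by (intro image_mset_cong) simp
  then show ?thesis by (simp add: image_mset_const_eq)
qed

lemma replicate_mset_add: "replicate_mset (a + b) x = replicate_mset a x + replicate_mset b x"
  by (induction a) auto

text \<open>Classify the points by the set of positions with values in \<open>A\<close>: each \<open>k\<close>-element set of positions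
  contributes a product set.\<close>

lemma card_PiE_with_count:
  assumes "finite I" "finite A" "finite B" "A \<inter> B = {}"
  shows "card {z \<in> (\<Pi>\<^sub>E j\<in>I. A \<union> B). card {j \<in> I. z j \<in> A} = k}
    = (card I choose k) * card A ^ k * card B ^ (card I - k)"
proof -
  let ?S = "\<lambda>K. \<Pi>\<^sub>E j\<in>I. if j \<in> K then A else B"
  have S_iff: "z \<in> ?S K \<longleftrightarrow> z \<in> (\<Pi>\<^sub>E j\<in>I. A \<union> B) \<and> {j \<in> I. z j \<in> A} = K" if "K \<subseteq> I" for z K
    using that assms(4) by (auto simp: PiE_iff split: if_splits)
  have "{z \<in> (\<Pi>\<^sub>E j\<in>I. A \<union> B). card {j \<in> I. z j \<in> A} = k} = (\<Union>K\<in>{K. K \<subseteq> I \<and> card K = k}. ?S K)"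
  proof (intro Set.set_eqI iffI)
    fix z assume z: "z \<in> {z \<in> (\<Pi>\<^sub>E j\<in>I. A \<union> B). card {j \<in> I. z j \<in> A} = k}"
    have "z \<in> ?S {j \<in> I. z j \<in> A}"
      by (subst S_iff) (use z in simp_all)
    moreover have "{j \<in> I. z j \<in> A} \<in> {K. K \<subseteq> I \<and> card K = k}" using z by simp
    ultimately show "z \<in> (\<Union>K\<in>{K. K \<subseteq> I \<and> card K = k}. ?S K)" by (rule UN_I[rotated])
  next
    fix z assume "z \<in> (\<Union>K\<in>{K. K \<subseteq> I \<and> card K = k}. ?S K)"
    then obtain K where K: "K \<in> {K. K \<subseteq> I \<and> card K = k}" "z \<in> ?S K" by (rule UN_E)
    with S_iff[of K z] show "z \<in> {z \<in> (\<Pi>\<^sub>E j\<in>I. A \<union> B). card {j \<in> I. z j \<in> A} = k}"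
      by simp
  qed
  also have "card \<dots> = (\<Sum>K\<in>{K. K \<subseteq> I \<and> card K = k}. card (?S K))"
  proof (rule card_UN_disjoint)
    show "finite {K. K \<subseteq> I \<and> card K = k}" using assms(1) by simp
    show "\<forall>K\<in>{K. K \<subseteq> I \<and> card K = k}. finite (?S K)"
      using assms by (auto intro!: finite_PiE)
    show "\<forall>K\<in>{K. K \<subseteq> I \<and> card K = k}. \<forall>K'\<in>{K. K \<subseteq> I \<and> card K = k}. K \<noteq> K' \<longrightarrow> ?S K \<inter> ?S K' = {}"
    proof (intro ballI impI equals0I)
      fix K K' z assume K: "K \<in> {K. K \<subseteq> I \<and> card K = k}" "K' \<in> {K. K \<subseteq> I \<and> card K = k}"
        and ne: "K \<noteq> K'" and z: "z \<in> ?S K \<inter> ?S K'"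
      have "{j \<in> I. z j \<in> A} = K" using K(1) z S_iff[of K z] by simp
      moreover have "{j \<in> I. z j \<in> A} = K'" using K(2) z S_iff[of K' z] by simp
      ultimately have "K = K'" by (rule trans[OF sym])
      with ne show False by contradiction
    qed
  qed
  also have "\<dots> = (\<Sum>K\<in>{K. K \<subseteq> I \<and> card K = k}. card A ^ k * card B ^ (card I - k))"
  proof (rule sum.cong)
    fix K assume "K \<in> {K. K \<subseteq> I \<and> card K = k}"
    then have K: "K \<subseteq> I" "card K = k" by auto
    then have fK: "finite K" using assms(1) finite_subset by blast
    have "card (?S K) = (\<Prod>j\<in>I. if j \<in> K then card A else card B)"
      using assms(1) by (simp add: card_PiE if_distrib)
    also have "\<dots> = card A ^ card (I \<inter> K) * card B ^ card (I - K)"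
      using assms(1) by (simp add: prod.If_cases Diff_eq)
    also have "\<dots> = card A ^ k * card B ^ (card I - k)"
      using K fK by (simp add: card_Diff_subset Int_absorb1)
    finally show "card (?S K) = card A ^ k * card B ^ (card I - k)" .
  qed simp
  also have "\<dots> = (card I choose k) * card A ^ k * card B ^ (card I - k)"
    using assms(1) by (simp add: n_subsets)
  finally show ?thesis .
qed

text \<open>If each coordinate contributes a factor 0, 1 or \<open>a\<close>, the product is 0 or a power of
  \<open>a\<close>, and the multiplicities of the powers are the terms of the expansion of \<open>(p + q) ^ card I\<close>.\<close>

lemma image_mset_prod_PiE:
  fixes f :: "'b \<Rightarrow> 'c :: comm_semiring_1"
  assumes "finite I" "finite B" and vals: "\<And>b. b \<in> B \<Longrightarrow> f b \<in> {0, 1, a}" and a: "a \<noteq> 0" "a \<noteq> 1"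
  defines "p \<equiv> card {b \<in> B. f b = a}" and "q \<equiv> card {b \<in> B. f b = 1}"
  shows "image_mset (\<lambda>z. c * (\<Prod>j\<in>I. f (z j))) (mset_set (\<Pi>\<^sub>E j\<in>I. B)) =
    replicate_mset (card B ^ card I - (p + q) ^ card I) 0 +
    (\<Sum>k\<le>card I. replicate_mset ((card I choose k) * p ^ k * q ^ (card I - k)) (c * a ^ k))"
proof -
  let ?A = "{b \<in> B. f b = a}" and ?O = "{b \<in> B. f b = 1}"
  let ?P = "\<Pi>\<^sub>E j\<in>I. B" and ?Q = "\<Pi>\<^sub>E j\<in>I. ?A \<union> ?O"
  let ?F = "\<lambda>z. c * (\<Prod>j\<in>I. f (z j))" and ?h = "\<lambda>z. card {j \<in> I. z j \<in> ?A}"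
  have fin: "finite ?P" "finite ?Q" using assms(1,2) by (auto intro!: finite_PiE)
  have disj: "?A \<inter> ?O = {}" using a by auto
  have sub: "?Q \<subseteq> ?P" by (rule PiE_mono) auto
  have "card (?A \<union> ?O) = p + q"
    unfolding p_def q_def using assms(2) disj by (intro card_Un_disjoint) auto
  then have card: "card (?P - ?Q) = card B ^ card I - (p + q) ^ card I"
    using fin sub assms(1) by (simp add: card_Diff_subset card_PiE)
  have zero: "image_mset ?F (mset_set (?P - ?Q)) = replicate_mset (card (?P - ?Q)) 0"
  proof (rule image_mset_const_on)
    fix z assume "z \<in> ?P - ?Q"
    then obtain j where "j \<in> I" "z j \<in> B" "z j \<notin> ?A \<union> ?O" by (auto simp: PiE_iff)
    then have "f (z j) = 0" using vals by auto
    then have "(\<Prod>j\<in>I. f (z j)) = 0" using \<open>j \<in> I\<close> assms(1) by (intro prod_zero) auto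
    then show "?F z = 0" by simp
  qed (use fin in simp)
  have on_Q: "?F z = c * a ^ ?h z" if z: "z \<in> ?Q" for z
  proof -
    have "(\<Prod>j\<in>I. f (z j)) = (\<Prod>j\<in>I. if z j \<in> ?A then a else 1)"
      using PiE_mem[OF z] by (intro prod.cong) auto
    also have "\<dots> = a ^ ?h z" using assms(1) by (simp add: prod.If_cases Int_def)
    finally show ?thesis by simp
  qed
  have "mset_set ?Q = (\<Sum>k\<le>card I. mset_set {z \<in> ?Q. ?h z = k})"
  proof -
    have "?h ` ?Q \<subseteq> {..card I}" using assms(1) by (auto intro!: card_mono)
    from sum.group[OF fin(2) _ this, of "\<lambda>z. {#z#}"] show ?thesis by simp
  qed
  then have "image_mset ?F (mset_set ?Q) = (\<Sum>k\<le>card I. image_mset ?F (mset_set {z \<in> ?Q. ?h z = k}))"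
    by (simp add: image_mset_sum)
  also have "\<dots> = (\<Sum>k\<le>card I. replicate_mset ((card I choose k) * p ^ k * q ^ (card I - k)) (c * a ^ k))"
  proof (rule sum.cong)
    fix k
    have "image_mset ?F (mset_set {z \<in> ?Q. ?h z = k}) = replicate_mset (card {z \<in> ?Q. ?h z = k}) (c * a ^ k)"
      using fin on_Q by (intro image_mset_const_on) auto
    also have "card {z \<in> ?Q. ?h z = k} = (card I choose k) * p ^ k * q ^ (card I - k)"
      unfolding p_def q_def using assms(1,2) disj by (intro card_PiE_with_count) auto
    finally show "image_mset ?F (mset_set {z \<in> ?Q. ?h z = k})
      = replicate_mset ((card I choose k) * p ^ k * q ^ (card I - k)) (c * a ^ k)" .
  qed simp
  finally have "image_mset ?F (mset_set ?Q)
    = (\<Sum>k\<le>card I. replicate_mset ((card I choose k) * p ^ k * q ^ (card I - k)) (c * a ^ k))" .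
  moreover have "mset_set ?P = mset_set (?P - ?Q) + mset_set ?Q"
  proof -
    have "(?P - ?Q) \<union> ?Q = ?P" using sub by (simp add: Un_absorb2)
    then show ?thesis using fin mset_set_Union[of "?P - ?Q" ?Q] by (simp only:) blast
  qed
  ultimately show ?thesis using zero card by simp
qed

lemma image_mset_overlap:
  assumes "w \<in> {0, 1}" and vals: "\<And>t. t \<in> C4 \<Longrightarrow> overlap w t \<in> {0, 1, a}" and "a > 1"
    and p: "card {t \<in> C4. overlap w t = a} = p" and q: "card {t \<in> C4. overlap w t = 1} = q"
  shows "image_mset (\<lambda>z. int (weight (Z2_Z4_pow m) (T_lift m) (w, z))) (mset_set (\<Pi>\<^sub>E j\<in>{1..m}. C4)) =
    replicate_mset (16 ^ m - (p + q) ^ m) 0 +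
    (\<Sum>k\<le>m. replicate_mset ((m choose k) * p ^ k * q ^ (m - k)) (2 * int a ^ k))"
proof -
  have "image_mset (\<lambda>z. int (weight (Z2_Z4_pow m) (T_lift m) (w, z))) (mset_set (\<Pi>\<^sub>E j\<in>{1..m}. C4))
    = image_mset (\<lambda>z. 2 * (\<Prod>j\<in>{1..m}. int (overlap w (z j)))) (mset_set (\<Pi>\<^sub>E j\<in>{1..m}. C4))"
    using assms(1) by (intro image_mset_cong) (simp add: weight_T_lift finite_C4 finite_PiE)
  also have "\<dots> = replicate_mset (card C4 ^ card {1..m} - (p + q) ^ card {1..m}) 0 +
    (\<Sum>k\<le>card {1..m}. replicate_mset ((card {1..m} choose k) * p ^ k * q ^ (card {1..m} - k)) (2 * int a ^ k))"
    using image_mset_prod_PiE[of "{1..m}" C4 "\<lambda>t. int (overlap w t)" "int a" 2] vals \<open>a > 1\<close> p q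
    by (simp add: finite_C4)
  finally show ?thesis by (simp add: card_C4)
qed

section \<open>The lifted pair\<close>

theorem theorem3p1:
  fixes m :: nat
  assumes "m \<ge> 1"
  shows "partition_on (S_base m) {S0_part m, S1_part m} \<and> S0_part m \<inter> S1_part m = {} \<and>
         primitive_formally_dual_pair (Z2_Z4_pow m) (phi m) (S_lift m) (T_lift m) \<and>
         image_mset
           (gr_mult (Z2_Z4_pow m) (indicator (T_lift m))
             (gr_inv (Z2_Z4_pow m) (indicator (T_lift m))))
           (mset_set (carrier (Z2_Z4_pow m))) =
         (replicate_mset (2 ^ (4 * m + 1) - 10 ^ m - 13 ^ m) 0 +
          (\<Sum>l \<in> {l \<in> {1..m + 1}. odd l}.
             replicate_mset
               (12 ^ (m - (l - 1) div 2) * (m choose ((l - 1) div 2)) +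
                2 ^ (2 * m - l + 1) * 3 ^ (l - 1) * (m choose (l - 1)))
               (2 ^ l))) +
         (\<Sum>l \<in> {l \<in> {2..m + 1}. even l}.
            replicate_mset (2 ^ (2 * m - l + 1) * 3 ^ (l - 1) * (m choose (l - 1))) (2 ^ l)) +
         (\<Sum>l \<in> {l \<in> {m + 2..2 * m + 1}. odd l}.
            replicate_mset (12 ^ (m - (l - 1) div 2) * (m choose ((l - 1) div 2))) (2 ^ l))"
proof (intro conjI)
  show "S0_part m \<inter> S1_part m = {}"
    by (auto simp: S0_part_eq S1_part_eq)
  have in_L: "(0, 0) \<in> L_set" "(3, 3) \<in> L_set" by (simp_all add: L_set_def)
  have zero: "coord m 1 (0, 0) \<in> S0_part m"
    using coord_in_PiE[OF in_L(1,1), of m 1] by (simp add: S0_part_eq S_base_def twists_coord)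
  have one: "coord m 1 (3, 3) \<in> S1_part m"
    using coord_in_PiE[OF in_L, of m 1] assms by (simp add: S1_part_eq S_base_def twists_coord)
  have "S_base m = S0_part m \<union> S1_part m"
    by (auto simp: S0_part_eq S1_part_eq)
  then show "partition_on (S_base m) {S0_part m, S1_part m}"
    using zero one \<open>S0_part m \<inter> S1_part m = {}\<close> by (auto simp: partition_on_def disjoint_def)
  show "primitive_formally_dual_pair (Z2_Z4_pow m) (phi m) (S_lift m) (T_lift m)"
    using assms by (simp add: primitive_formally_dual_pair_def formally_dual_pair_lift
        primitive_S_lift primitive_T_lift)
next
  let ?G = "Z2_Z4_pow m" and ?P = "\<Pi>\<^sub>E j\<in>{1..m}. C4"
  let ?W = "\<lambda>g. int (weight ?G (T_lift m) g)"
  interpret comm_group ?G by (rule comm_group_Z2_Z4_pow)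
  define \<alpha> where "\<alpha> l = (12 ^ (m - (l - 1) div 2) * (m choose ((l - 1) div 2)) :: nat)" for l
  define \<beta> where "\<beta> l = (2 ^ (2 * m - l + 1) * 3 ^ (l - 1) * (m choose (l - 1)) :: nat)" for l
  let ?A = "\<lambda>l. replicate_mset (\<alpha> l) (2 ^ l :: int)" and ?B = "\<lambda>l. replicate_mset (\<beta> l) (2 ^ l :: int)"
  have finP: "finite ?P" by (intro finite_PiE) (auto simp: finite_C4)
  have autocorrelation: "gr_mult ?G (indicator (T_lift m)) (gr_inv ?G (indicator (T_lift m))) = ?W"
    by (rule ext) (rule gr_mult_indicator_inv[OF finite_Z2_Z4_pow T_lift_subset])
  have carrier_mset: "mset_set (carrier ?G) = image_mset (Pair 0) (mset_set ?P) + image_mset (Pair 1) (mset_set ?P)"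
  proof -
    have "carrier ?G = Pair 0 ` ?P \<union> Pair 1 ` ?P" unfolding carrier_Z2_Z4_pow by blast
    moreover have "mset_set (Pair (0 :: int) ` ?P \<union> Pair 1 ` ?P) = mset_set (Pair 0 ` ?P) + mset_set (Pair 1 ` ?P)"
      using finP by (intro mset_set_Union) auto
    ultimately show ?thesis by (simp add: image_mset_mset_set inj_on_def)
  qed
  have "image_mset (gr_mult ?G (indicator (T_lift m)) (gr_inv ?G (indicator (T_lift m))))
      (mset_set (carrier ?G)) =
      image_mset (\<lambda>z. ?W (0, z)) (mset_set ?P) + image_mset (\<lambda>z. ?W (1, z)) (mset_set ?P)"
    unfolding autocorrelation carrier_mset by (simp add: image_mset.compositionality comp_def)
  also have "image_mset (\<lambda>z. ?W (0, z)) (mset_set ?P) = replicate_mset (16 ^ m - (1 + 12) ^ m) 0 +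
      (\<Sum>k\<le>m. replicate_mset ((m choose k) * 1 ^ k * 12 ^ (m - k)) (2 * int 4 ^ k))"
    by (rule image_mset_overlap) (simp_all add: card_overlap overlap_0 del: One_nat_def)
  also have "image_mset (\<lambda>z. ?W (1, z)) (mset_set ?P) = replicate_mset (16 ^ m - (6 + 4) ^ m) 0 +
      (\<Sum>k\<le>m. replicate_mset ((m choose k) * 6 ^ k * 4 ^ (m - k)) (2 * int 2 ^ k))"
    by (rule image_mset_overlap) (simp_all add: card_overlap overlap_1 del: One_nat_def)
  \<comment> \<open>Over the layer \<open>w = 0\<close> the value \<open>2 * 4 ^ k\<close> is \<open>2 ^ l\<close> with \<open>l = 2 * k + 1\<close>.\<close>
  also have "(\<Sum>k\<le>m. replicate_mset ((m choose k) * 1 ^ k * 12 ^ (m - k)) (2 * int 4 ^ k))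
      = (\<Sum>l\<in>{l \<in> {1..2 * m + 1}. odd l}. ?A l)"
  proof (rule sum.reindex_bij_witness[of _ "\<lambda>l. (l - 1) div 2" "\<lambda>k. 2 * k + 1"])
    fix k
    have "2 * int 4 ^ k = 2 ^ (2 * k + 1)" by (simp add: power_mult)
    then show "?A (2 * k + 1) = replicate_mset ((m choose k) * 1 ^ k * 12 ^ (m - k)) (2 * int 4 ^ k)"
      by (simp add: \<alpha>_def mult.commute)
  qed (auto elim!: oddE)
  \<comment> \<open>Over the layer \<open>w = 1\<close> the value \<open>2 * 2 ^ k\<close> is \<open>2 ^ l\<close> with \<open>l = k + 1\<close>.\<close>
  also have "(\<Sum>k\<le>m. replicate_mset ((m choose k) * 6 ^ k * 4 ^ (m - k)) (2 * int 2 ^ k))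
      = (\<Sum>l\<in>{1..m + 1}. ?B l)"
  proof (rule sum.reindex_bij_witness[of _ "\<lambda>l. l - 1" "\<lambda>k. k + 1"])
    fix k assume "k \<in> {..m}"
    \<comment> \<open>The truncated subtraction \<open>2 * m - l\<close> is exact because \<open>l \<le> m + 1 \<le> 2 * m\<close>.\<close>
    then have "2 * m - (k + 1) + 1 = k + 2 * (m - k)" using assms by simp
    then have "(2 :: nat) ^ (2 * m - (k + 1) + 1) * 3 ^ k = (2 * 3) ^ k * (2 ^ 2) ^ (m - k)"
      by (simp only: power_add power_mult_distrib power_mult[symmetric] mult.assoc mult.commute mult.left_commute)
    then show "?B (k + 1) = replicate_mset ((m choose k) * 6 ^ k * 4 ^ (m - k)) (2 * int 2 ^ k)"
      by (simp add: \<beta>_def mult_ac)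
  qed auto
  also have "(\<Sum>l\<in>{l \<in> {1..2 * m + 1}. odd l}. ?A l)
      = (\<Sum>l\<in>{l \<in> {1..m + 1}. odd l}. ?A l) + (\<Sum>l\<in>{l \<in> {m + 2..2 * m + 1}. odd l}. ?A l)"
  proof -
    have "{l \<in> {1..2 * m + 1}. odd l} = {l \<in> {1..m + 1}. odd l} \<union> {l \<in> {m + 2..2 * m + 1}. odd l}"
      by auto
    moreover have "sum ?A ({l \<in> {1..m + 1}. odd l} \<union> {l \<in> {m + 2..2 * m + 1}. odd l}) =
        sum ?A {l \<in> {1..m + 1}. odd l} + sum ?A {l \<in> {m + 2..2 * m + 1}. odd l}"
      by (rule sum.union_disjoint) auto
    ultimately show ?thesis by (simp only:)
  qed
  also have "(\<Sum>l\<in>{1..m + 1}. ?B l)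
      = (\<Sum>l\<in>{l \<in> {1..m + 1}. odd l}. ?B l) + (\<Sum>l\<in>{l \<in> {2..m + 1}. even l}. ?B l)"
  proof -
    have "{l \<in> {2..m + 1}. even l} = {l \<in> {1..m + 1}. \<not> odd l}"
      by (auto simp: Suc_le_eq elim!: evenE)
    moreover have "{1..m + 1} = {l \<in> {1..m + 1}. odd l} \<union> {l \<in> {1..m + 1}. \<not> odd l}"
      by blast
    moreover have "sum ?B ({l \<in> {1..m + 1}. odd l} \<union> {l \<in> {1..m + 1}. \<not> odd l}) =
        sum ?B {l \<in> {1..m + 1}. odd l} + sum ?B {l \<in> {1..m + 1}. \<not> odd l}"
      by (rule sum.union_disjoint) auto
    ultimately show ?thesis by (simp only:)
  qed
  finally have eq: "image_mset (gr_mult ?G (indicator (T_lift m)) (gr_inv ?G (indicator (T_lift m))))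
      (mset_set (carrier ?G)) =
      replicate_mset (16 ^ m - (1 + 12) ^ m) 0
      + ((\<Sum>l\<in>{l \<in> {1..m + 1}. odd l}. ?A l) + (\<Sum>l\<in>{l \<in> {m + 2..2 * m + 1}. odd l}. ?A l))
      + (replicate_mset (16 ^ m - (6 + 4) ^ m) 0
      + ((\<Sum>l\<in>{l \<in> {1..m + 1}. odd l}. ?B l) + (\<Sum>l\<in>{l \<in> {2..m + 1}. even l}. ?B l)))" .
  have "(13 :: nat) ^ m \<le> 16 ^ m" "(10 :: nat) ^ m \<le> 16 ^ m" by (auto intro: power_mono)
  moreover have "(2 :: nat) ^ (4 * m + 1) = 16 ^ m + 16 ^ m" by (simp add: power_mult)
  ultimately have "(2 :: nat) ^ (4 * m + 1) - 10 ^ m - 13 ^ m = (16 ^ m - (1 + 12) ^ m) + (16 ^ m - (6 + 4) ^ m)"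
    by simp
  then have zeros: "replicate_mset (2 ^ (4 * m + 1) - 10 ^ m - 13 ^ m) (0 :: int)
      = replicate_mset (16 ^ m - (1 + 12) ^ m) 0 + replicate_mset (16 ^ m - (6 + 4) ^ m) 0"
    by (simp only: replicate_mset_add)
  show "image_mset (gr_mult ?G (indicator (T_lift m)) (gr_inv ?G (indicator (T_lift m))))
      (mset_set (carrier ?G)) =
         (replicate_mset (2 ^ (4 * m + 1) - 10 ^ m - 13 ^ m) 0 +
          (\<Sum>l \<in> {l \<in> {1..m + 1}. odd l}.
             replicate_mset
               (12 ^ (m - (l - 1) div 2) * (m choose ((l - 1) div 2)) +
                2 ^ (2 * m - l + 1) * 3 ^ (l - 1) * (m choose (l - 1)))
               (2 ^ l))) +
         (\<Sum>l \<in> {l \<in> {2..m + 1}. even l}.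
            replicate_mset (2 ^ (2 * m - l + 1) * 3 ^ (l - 1) * (m choose (l - 1))) (2 ^ l)) +
         (\<Sum>l \<in> {l \<in> {m + 2..2 * m + 1}. odd l}.
            replicate_mset (12 ^ (m - (l - 1) div 2) * (m choose ((l - 1) div 2))) (2 ^ l))"
    unfolding eq zeros \<alpha>_def[symmetric] \<beta>_def[symmetric] replicate_mset_add sum.distrib
    by (simp only: ac_simps)
qed

end
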